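(* The remoteness function $\mathcal{R}$ of the games $\mathrm{NIM}(n,n-1)$ can be computed in polynomial time, even if $n$ is a part of the input and integers are presented in binary. That is, there is an algorithm which, given an integer $n\ge 2$ and a position $x=(x_1,\dots,x_n)$ of $\mathrm{NIM}(n,n-1)$ with the nonnegative integers $x_1,\dots,x_n$ written in binary, outputs $\mathcal{R}(x)$ in time polynomial in the length of the input.
   Context: The game $\mathrm{NIM}(n,k)$ ($0<k\le n$): a position is an $n$-tuple $x=(x_1,\dots,x_n)$ of nonnegative integers (pile sizes). By one move a player chooses $k$ piles, all of them nonempty, and removes exactly one stone from each of them. Two players alternate turns; a player who has to move but cannot loses. A position is terminal if no move is possible from it. Here $k=n-1$. Smith's remoteness function $\mathcal{R}$ is defined by the following labeling of the positions of the game: set $\mathcal{R}=0$ for all terminal positions and $\mathcal{R}(x)=1$ if and only if there is a move from $x$ to a terminal position; delete all labeled positions and repeat the procedure on the remaining digraph with labels increased by $2$ (that is, assign $2$ and $3$ instead of $0$ and $1$), and so on. Equivalently, with $N^+(x)$ the set of positions reachable from $x$ by one move: $\mathcal{R}(x)=0$ if $N^+(x)=\emptyset$; $\mathcal{R}(x)=1+\min\{\mathcal{R}(y): y\in N^+(x),\ \mathcal{R}(y)\text{ even}\}$ if some $y\in N^+(x)$ has even $\mathcal{R}(y)$; and $\mathcal{R}(x)=1+\max\{\mathcal{R}(y): y\in N^+(x)\}$ if $N^+(x)\ne\emptyset$ and all $y\in N^+(x)$ have odd $\mathcal{R}(y)$. *)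

theory Defs
  imports "HOL-Computational_Algebra.Polynomial"
begin

section \<open>Remoteness\<close>

text \<open>A game is given by the function \<open>N\<close> that maps a position to the set of positions
  reachable from it by one move. \<open>labeled N i\<close> is the set of positions deleted in the first \<open>i\<close>
  rounds of Smith's procedure; round \<open>i\<close> assigns the labels \<open>2 * i\<close> and \<open>2 * i + 1\<close>.\<close>

definition even_round :: "('a \<Rightarrow> 'a set) \<Rightarrow> 'a set \<Rightarrow> 'a set" where
  "even_round N L = {x. x \<notin> L \<and> N x \<subseteq> L}"

definition odd_round :: "('a \<Rightarrow> 'a set) \<Rightarrow> 'a set \<Rightarrow> 'a set" where
  "odd_round N L = {x. x \<notin> L \<and> N x \<inter> even_round N L \<noteq> {}}"

primrec labeled :: "('a \<Rightarrow> 'a set) \<Rightarrow> nat \<Rightarrow> 'a set" where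
  "labeled N 0 = {}"
| "labeled N (Suc i) =
     labeled N i \<union> even_round N (labeled N i) \<union> odd_round N (labeled N i)"

definition has_label :: "('a \<Rightarrow> 'a set) \<Rightarrow> 'a \<Rightarrow> nat \<Rightarrow> bool" where
  "has_label N x r \<longleftrightarrow>
     (\<exists>i. r = 2 * i \<and> x \<in> even_round N (labeled N i) \<or>
          r = 2 * i + 1 \<and> x \<in> odd_round N (labeled N i))"

definition remoteness :: "('a \<Rightarrow> 'a set) \<Rightarrow> 'a \<Rightarrow> nat" where
  "remoteness N x = (THE r. has_label N x r)"

section \<open>The game NIM(n,k)\<close>

definition nim_positions :: "nat \<Rightarrow> nat list set" where
  "nim_positions n = {x. length x = n}"

definition nim :: "nat \<Rightarrow> nat \<Rightarrow> nat list \<Rightarrow> nat list set" where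
  "nim n k x =
     {map (\<lambda>i. if i \<in> S then x ! i - 1 else x ! i) [0..<n] | S.
        S \<subseteq> {..<n} \<and> card S = k \<and> (\<forall>i\<in>S. x ! i > 0)}"

text \<open>The label used in \<^const>\<open>remoteness\<close> exists and is unique.\<close>

lemma labeled_mono: "i \<le> j \<Longrightarrow> labeled N i \<subseteq> labeled N j"
  by (rule lift_Suc_mono_le[where f = "labeled N"]) auto

lemma has_label_unique:
  assumes "has_label N x r" "has_label N x s"
  shows "r = s"
proof -
  have round: "x \<notin> labeled N (t div 2) \<and> x \<in> labeled N (Suc (t div 2)) \<and>
      (even t \<longleftrightarrow> x \<in> even_round N (labeled N (t div 2)))" if "has_label N x t" for t
  proof -
    from that obtain i where
      "t = 2 * i \<and> x \<in> even_round N (labeled N i) \<or>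
       t = 2 * i + 1 \<and> x \<in> odd_round N (labeled N i)"
      unfolding has_label_def by blast
    then show ?thesis
    proof (elim disjE conjE)
      assume "t = 2 * i" "x \<in> even_round N (labeled N i)"
      then show ?thesis by (simp add: even_round_def)
    next
      assume t: "t = 2 * i + 1" and x: "x \<in> odd_round N (labeled N i)"
      then have "x \<notin> labeled N i" "x \<notin> even_round N (labeled N i)"
        unfolding even_round_def odd_round_def by blast+
      with t x show ?thesis by simp
    qed
  qed
  have "r div 2 = s div 2"
    using round[OF assms(1)] round[OF assms(2)]
      labeled_mono[of "Suc (r div 2)" "s div 2" N] labeled_mono[of "Suc (s div 2)" "r div 2" N]
    by (meson Suc_leI linorder_neqE_nat subsetD)
  moreover from this have "even r \<longleftrightarrow> even s"
    using round[OF assms(1)] round[OF assms(2)] by simp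
  ultimately show ?thesis by presburger
qed

lemma nim_has_label:
  assumes "0 < k" "x \<in> nim_positions n"
  shows "\<exists>r. has_label (nim n k) x r"
proof -
  have moves: "y \<in> nim_positions n \<and> sum_list y < sum_list x"
    if "y \<in> nim n k x" "x \<in> nim_positions n" for x y
  proof -
    obtain S where S: "S \<subseteq> {..<n}" "card S = k" "\<forall>i\<in>S. x ! i > 0"
      and y: "y = map (\<lambda>i. if i \<in> S then x ! i - 1 else x ! i) [0..<n]"
      using \<open>y \<in> nim n k x\<close> unfolding nim_def by blast
    obtain j where j: "j \<in> S" using S(2) \<open>0 < k\<close> by fastforce
    have "(\<Sum>i<n. y ! i) < (\<Sum>i<n. x ! i)"
    proof (rule sum_strict_mono_ex1)
      show "\<forall>i\<in>{..<n}. y ! i \<le> x ! i" by (simp add: y)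
      have "j < n" "y ! j < x ! j" using j S by (auto simp: y)
      then show "\<exists>i\<in>{..<n}. y ! i < x ! i" by blast
    qed simp
    then show ?thesis
      using y that(2) by (simp add: nim_positions_def sum_list_sum_nth atLeast0LessThan)
  qed
  have fin: "finite (nim n k x)" for x
  proof (rule finite_subset)
    show "nim n k x \<subseteq> (\<lambda>S. map (\<lambda>i. if i \<in> S then x ! i - 1 else x ! i) [0..<n]) ` Pow {..<n}"
      unfolding nim_def by blast
  qed simp
  have "\<exists>i. x \<in> labeled (nim n k) i" if "x \<in> nim_positions n" for x
    using that
  proof (induction "sum_list x" arbitrary: x rule: less_induct)
    case less
    have "\<forall>y\<in>nim n k x. \<exists>i. y \<in> labeled (nim n k) i"
      using less moves by blast
    then obtain f where f: "\<forall>y\<in>nim n k x. y \<in> labeled (nim n k) (f y)" by metis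
    define m where "m = Max (insert 0 (f ` nim n k x))"
    have "f y \<le> m" if "y \<in> nim n k x" for y
      unfolding m_def using that fin by simp
    then have "nim n k x \<subseteq> labeled (nim n k) m"
      using f labeled_mono[of _ m "nim n k"] by (meson subset_iff)
    then have "x \<in> labeled (nim n k) (Suc m)"
      unfolding labeled.simps even_round_def by blast
    then show ?case ..
  qed
  then obtain i where "x \<in> labeled (nim n k) i" using assms(2) by blast
  then show ?thesis
  proof (induction i)
    case (Suc i)
    then show ?case unfolding labeled.simps Un_iff has_label_def by blast
  qed simp
qed

section \<open>Binary representation\<close>

text \<open>Words are lists of symbols, and symbols are coded by natural numbers:
  0 and 1 are the binary digits and 2 is a separator.\<close>

type_synonym word = "nat list"

text \<open>Most significant digit first, without leading zeros; zero is written as \<open>[0]\<close>.\<close>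

fun binary :: "nat \<Rightarrow> word" where
  "binary n = (if n < 2 then [n] else binary (n div 2) @ [n mod 2])"

declare binary.simps [simp del]

text \<open>The number of piles followed by the pile sizes, each of them in binary and terminated by
  a separator.\<close>

definition encode_position :: "nat \<times> nat list \<Rightarrow> word" where
  "encode_position = (\<lambda>(n, x). concat (map (\<lambda>a. binary a @ [2]) (n # x)))"

section \<open>Random access machines\<close>

text \<open>Polynomial time refers to the random access machine of Cook and Reckhow (1973) with
  logarithmic cost, which simulates and is simulated by Turing machines with
  polynomial overhead. Its registers \<open>X\<^sub>0, X\<^sub>1, \<dots>\<close> hold natural numbers and are initially 0,
  and subtraction is truncated at 0. The only arithmetic operations are addition and
  subtraction. \<open>Load i j\<close> is \<open>X\<^sub>i := X\<^bsub>X\<^sub>j\<^esub>\<close>, \<open>Store i j\<close> is \<open>X\<^bsub>X\<^sub>i\<^esub> := X\<^sub>j\<close>,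
  and \<open>Jump j l\<close> continues with instruction \<open>l\<close> if \<open>X\<^sub>j > 0\<close>.
  \<open>Read i\<close> consumes one input symbol \<open>a\<close> and sets \<open>X\<^sub>i\<close> to \<open>a + 1\<close>; it sets
  \<open>X\<^sub>i\<close> to 0 if the input is exhausted. \<open>Print j\<close> appends \<open>X\<^sub>j\<close> to the output.
  The machine halts when the program counter leaves the program.\<close>

datatype instr =
    Const nat nat
  | Add nat nat nat
  | Sub nat nat nat
  | Load nat nat
  | Store nat nat
  | Jump nat nat
  | Read nat
  | Print nat

type_synonym program = "instr list"

text \<open>Program counter, registers, remaining input, output so far.\<close>

type_synonym config = "nat \<times> (nat \<Rightarrow> nat) \<times> word \<times> word"

fun next_symbol :: "word \<Rightarrow> nat" where
  "next_symbol [] = 0"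
| "next_symbol (a # u) = Suc a"

fun exec :: "instr \<Rightarrow> config \<Rightarrow> config" where
  "exec (Const i c) (pc, X, u, v) = (Suc pc, X(i := c), u, v)"
| "exec (Add i j k) (pc, X, u, v) = (Suc pc, X(i := X j + X k), u, v)"
| "exec (Sub i j k) (pc, X, u, v) = (Suc pc, X(i := X j - X k), u, v)"
| "exec (Load i j) (pc, X, u, v) = (Suc pc, X(i := X (X j)), u, v)"
| "exec (Store i j) (pc, X, u, v) = (Suc pc, X(X i := X j), u, v)"
| "exec (Jump j l) (pc, X, u, v) = (if X j > 0 then l else Suc pc, X, u, v)"
| "exec (Read i) (pc, X, u, v) = (Suc pc, X(i := next_symbol u), tl u, v)"
| "exec (Print j) (pc, X, u, v) = (Suc pc, X, u, v @ [X j])"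

text \<open>Every number and every computed address that an instruction handles is charged its
  binary length.\<close>

abbreviation bits :: "nat \<Rightarrow> nat" where
  "bits a \<equiv> length (binary a)"

fun cost :: "instr \<Rightarrow> config \<Rightarrow> nat" where
  "cost (Const i c) (pc, X, u, v) = bits c"
| "cost (Add i j k) (pc, X, u, v) = bits (X j) + bits (X k)"
| "cost (Sub i j k) (pc, X, u, v) = bits (X j) + bits (X k)"
| "cost (Load i j) (pc, X, u, v) = bits (X j) + bits (X (X j))"
| "cost (Store i j) (pc, X, u, v) = bits (X i) + bits (X j)"
| "cost (Jump j l) (pc, X, u, v) = bits (X j)"
| "cost (Read i) (pc, X, u, v) = bits (next_symbol u)"
| "cost (Print j) (pc, X, u, v) = bits (X j)"

text \<open>\<open>run P c t c'\<close>: from \<open>c\<close> the program \<open>P\<close> reaches \<open>c'\<close> at total cost \<open>t\<close>.\<close>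

inductive run :: "program \<Rightarrow> config \<Rightarrow> nat \<Rightarrow> config \<Rightarrow> bool" for P where
  run_refl: "run P c 0 c"
| run_step: "fst c < length P \<Longrightarrow> run P (exec (P ! fst c) c) t c' \<Longrightarrow>
    run P c (cost (P ! fst c) c + t) c'"

definition halts_with :: "program \<Rightarrow> word \<Rightarrow> word \<Rightarrow> nat \<Rightarrow> bool" where
  "halts_with P w v t \<longleftrightarrow>
     (\<exists>pc X u. run P (0, \<lambda>_. 0, w, []) t (pc, X, u, v) \<and> pc \<ge> length P)"

text \<open>\<open>f\<close> is computable in polynomial time on the inputs in \<open>D\<close>, where \<open>enc\<close> encodes inputs
  and \<open>enc'\<close> encodes outputs as words.\<close>

definition polytime_computable_on ::
  "'a set \<Rightarrow> ('a \<Rightarrow> word) \<Rightarrow> ('b \<Rightarrow> word) \<Rightarrow> ('a \<Rightarrow> 'b) \<Rightarrow> bool" where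
  "polytime_computable_on D enc enc' f \<longleftrightarrow>
     (\<exists>(P :: program) (p :: nat poly). \<forall>a\<in>D. \<exists>t \<le> poly p (length (enc a)).
        halts_with P (enc a) (enc' (f a)) t)"

end

theory Submission
  imports Defs
begin

text \<open>It is optimal to keep a smallest even pile or, if all piles are odd, a largest one.
  After the first few moves, two consecutive moves of this kind lower every pile except a smallest
  one by two, up to the order of the piles. So a play of \<open>t\<close> moves is possible if about
  \<open>t / 2\<close> such double moves can make up for the piles below \<open>t\<close>, and up to
  parity corrections the remoteness of \<open>x\<close> is the largest \<open>t\<close> for which
  the sum of \<open>\<lceil>max 0 (t - x\<^sub>i) / 2\<rceil>\<close> is at most \<open>\<lfloor>t /
  2\<rfloor>\<close>. Once guessed, this formula is verified directly against the recursion of the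
  remoteness function, by comparing the condition for \<open>x\<close> and \<open>t + 1\<close> with
  that for a successor of \<open>x\<close> and \<open>t\<close>. The condition is inherited by
  smaller \<open>t\<close>, so the maximum can be found by binary search.\<close>

section \<open>Remoteness from local conditions\<close>

text \<open>The count behind the formula: grouped into double moves, a play of \<open>t\<close>
  moves takes \<open>t\<close> stones from a pile, minus two for each double move that spares it. So
  a pile of size \<open>a < t\<close> must be spared in at least half of \<open>t - a\<close> double
  moves, rounded up, and only \<open>t div 2\<close> are available. The comparison with a successor
  is short because a lowered pile together with a lowered target has an unchanged summand: only the
  kept pile and the two correction terms matter. The algorithm is shaped by a machine that can
  neither multiply nor divide. Halves and parities are built while digits are read, powers of two
  are made by doubling and kept on a stack, and the result is printed most significant digit first,
  as the search decides it. The search is for half of the result, since the sums for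
  \<open>2 * s\<close> and \<open>2 * s + 1\<close> need only halves and parities of the piles; one
  test at an odd number supplies the last digit.\<close>

lemma remoteness_eqI:
  fixes \<rho> :: "'a \<Rightarrow> nat"
  assumes closed: "\<And>x y. x \<in> D \<Longrightarrow> y \<in> N x \<Longrightarrow> y \<in> D"
    and pred: "\<And>x. x \<in> D \<Longrightarrow> 0 < \<rho> x \<Longrightarrow> \<exists>y\<in>N x. Suc (\<rho> y) = \<rho> x"
    and even: "\<And>x y. x \<in> D \<Longrightarrow> y \<in> N x \<Longrightarrow> even (\<rho> x) \<Longrightarrow> odd (\<rho> y) \<and> \<rho> y < \<rho> x"
    and odd: "\<And>x y. x \<in> D \<Longrightarrow> y \<in> N x \<Longrightarrow> odd (\<rho> x) \<Longrightarrow> even (\<rho> y) \<Longrightarrow> \<rho> x \<le> Suc (\<rho> y)"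
    and "x \<in> D"
  shows "remoteness N x = \<rho> x"
proof -
  \<comment> \<open>If the first rounds delete exactly the values below \<open>2 * i\<close>, the
    next one labels exactly \<open>2 * i\<close> and \<open>2 * i + 1\<close>. A larger value cannot
    enter the even round, because \<open>pred\<close> gives it an undeleted successor; it cannot
    enter the odd round, because \<open>even\<close> and \<open>odd\<close> bound the positions that
    have a successor of value \<open>2 * i\<close>.\<close>
  have rounds: "(x \<in> even_round N (labeled N i) \<longleftrightarrow> \<rho> x = 2 * i) \<and>
      (x \<in> odd_round N (labeled N i) \<longleftrightarrow> \<rho> x = 2 * i + 1)"
    if L: "\<And>x. x \<in> D \<Longrightarrow> x \<in> labeled N i \<longleftrightarrow> \<rho> x < 2 * i" and "x \<in> D" for i x
  proof -
    have ev: "x \<in> even_round N (labeled N i) \<longleftrightarrow> \<rho> x = 2 * i" if x: "x \<in> D" for x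
    proof
      assume *: "x \<in> even_round N (labeled N i)"
      then have ge: "\<rho> x \<ge> 2 * i" and lt: "\<And>y. y \<in> N x \<Longrightarrow> \<rho> y < 2 * i"
        using L x closed[OF x] by (auto simp: even_round_def)
      show "\<rho> x = 2 * i"
      proof (rule ccontr)
        assume "\<rho> x \<noteq> 2 * i"
        with ge pred[OF x] obtain y where "y \<in> N x" "Suc (\<rho> y) = \<rho> x" by fastforce
        with lt[of y] ge \<open>\<rho> x \<noteq> 2 * i\<close> show False by simp
      qed
    next
      assume "\<rho> x = 2 * i"
      then show "x \<in> even_round N (labeled N i)"
        using L x closed[OF x] even[OF x] by (auto simp: even_round_def)
    qed
    have "x \<in> odd_round N (labeled N i) \<longleftrightarrow> \<rho> x \<ge> 2 * i \<and> (\<exists>y\<in>N x. \<rho> y = 2 * i)"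
      using L[OF \<open>x \<in> D\<close>] ev[OF closed[OF \<open>x \<in> D\<close>]] by (auto simp: odd_round_def)
    also have "\<dots> \<longleftrightarrow> \<rho> x = 2 * i + 1"
    proof
      assume "\<rho> x = 2 * i + 1"
      then show "\<rho> x \<ge> 2 * i \<and> (\<exists>y\<in>N x. \<rho> y = 2 * i)" using pred[OF \<open>x \<in> D\<close>] by auto
    next
      assume *: "\<rho> x \<ge> 2 * i \<and> (\<exists>y\<in>N x. \<rho> y = 2 * i)"
      then obtain y where y: "y \<in> N x" "\<rho> y = 2 * i" by blast
      then have "odd (\<rho> x)" using even[OF \<open>x \<in> D\<close>, of y] by auto
      moreover have "\<rho> x \<le> Suc (2 * i)" using odd[OF \<open>x \<in> D\<close> y(1)] y(2) calculation by simp
      ultimately show "\<rho> x = 2 * i + 1" using * by (cases "\<rho> x = 2 * i") auto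
    qed
    finally show ?thesis using ev[OF \<open>x \<in> D\<close>] by blast
  qed
  have L: "x \<in> labeled N i \<longleftrightarrow> \<rho> x < 2 * i" if "x \<in> D" for x i
    using that
  proof (induction i arbitrary: x)
    case (Suc i)
    show ?case using rounds[OF Suc.IH Suc.prems] Suc.IH[OF Suc.prems] by auto
  qed simp
  have "has_label N x (\<rho> x)"
    unfolding has_label_def using rounds[OF L \<open>x \<in> D\<close>]
    by (intro exI[of _ "\<rho> x div 2"]) (simp, presburger)
  then show ?thesis
    unfolding remoteness_def using has_label_unique by (intro the_equality) auto
qed

section \<open>The remoteness of NIM(n, n - 1)\<close>

definition deficit :: "nat list \<Rightarrow> nat \<Rightarrow> nat" where
  "deficit x t = (\<Sum>i<length x. (t - x ! i + 1) div 2)"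

definition only_odd_below :: "nat list \<Rightarrow> nat \<Rightarrow> bool" where
  "only_odd_below x t \<longleftrightarrow> (\<forall>a\<in>set x. odd a \<and> a < t)"

definition even_below :: "nat list \<Rightarrow> nat \<Rightarrow> bool" where
  "even_below x t \<longleftrightarrow> (\<exists>a\<in>set x. even a \<and> a < t)"

text \<open>The correction term stems from the positions without a small even pile, in which the first move
  has to keep a largest pile instead.\<close>

definition feasible :: "nat list \<Rightarrow> nat \<Rightarrow> bool" where
  "feasible x t \<longleftrightarrow> deficit x t \<le> t div 2 +
     of_bool (if even t then only_odd_below x t else even_below x t)"

lemma only_odd_belowD: "only_odd_below x t \<Longrightarrow> a \<in> set x \<Longrightarrow> odd a \<and> a < t"
  unfolding only_odd_below_def by blast

lemma even_belowI: "a \<in> set x \<Longrightarrow> even a \<Longrightarrow> a < t \<Longrightarrow> even_below x t"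
  unfolding even_below_def by blast

text \<open>Half of a number, rounded up, grows with the number only if that number was even; the
  truncation at 0 adds the condition \<open>a \<le> t\<close>.\<close>

lemma half_diff_Suc:
  "(Suc t - a + 1) div 2 = (t - a + 1) div 2 + of_bool (a \<le> t \<and> even (t + a))"
proof (cases "a \<le> t")
  case True
  then obtain c where c: "t = a + c" using le_iff_add by blast
  have "(Suc c + 1) div 2 = (c + 1) div 2 + of_bool (even c)" by (cases "even c") auto
  moreover have "Suc t - a = Suc c" "t - a = c" "even (t + a) \<longleftrightarrow> even c" using c by auto
  ultimately show ?thesis using True by simp
next
  case False
  then have "Suc t - a = 0" "t - a = 0" by auto
  then show ?thesis using False by simp
qed

lemma deficit_Suc:
  "deficit x (Suc t) = deficit x t + card {i. i < length x \<and> x ! i \<le> t \<and> even (t + x ! i)}"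
  unfolding deficit_def half_diff_Suc
  by (simp add: sum.distrib of_bool_def Int_def flip: sum.inter_filter)

lemma feasible_0: "feasible x 0"
  by (simp add: feasible_def deficit_def)

text \<open>At an odd \<open>Suc t\<close> the budget can gain only the correction, and the even
  pile that earns it also raises the deficit. At an even \<open>Suc t\<close> the budget gains one,
  or two if all piles are odd and small; in the latter case every pile raises the deficit, and there
  are at least two.\<close>

lemma feasible_Suc_imp:
  assumes "2 \<le> length x" "feasible x (Suc t)"
  shows "feasible x t"
proof (cases "even t")
  case True
  define E where "E = {i. i < length x \<and> x ! i \<le> t \<and> even (t + x ! i)}"
  have "of_bool (even_below x (Suc t)) \<le> card E"
  proof (cases "even_below x (Suc t)")
    case ex: True
    then obtain i where "i \<in> E" using True
      by (auto simp: E_def even_below_def in_set_conv_nth less_Suc_eq_le)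
    moreover have "finite E" by (simp add: E_def)
    ultimately show ?thesis using card_gt_0_iff[of E] by (auto simp: of_bool_def)
  qed (simp add: of_bool_def)
  moreover have "deficit x t + card E \<le> t div 2 + of_bool (even_below x (Suc t))"
    using assms(2) True by (simp add: feasible_def deficit_Suc E_def)
  ultimately have "deficit x t \<le> t div 2" by linarith
  then show ?thesis unfolding feasible_def by linarith
next
  case False
  define E where "E = {i. i < length x \<and> x ! i \<le> t \<and> even (t + x ! i)}"
  have E: "finite E" by (simp add: E_def)
  have le: "deficit x t + card E \<le> Suc (t div 2) + of_bool (only_odd_below x (Suc t))"
    using assms(2) False by (simp add: feasible_def deficit_Suc E_def)
  show ?thesis
  proof (cases "even_below x t")
    case ex: True
    then have "\<not> only_odd_below x (Suc t)" by (auto simp: even_below_def only_odd_below_def)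
    then show ?thesis using le ex False by (simp add: feasible_def)
  next
    case nex: False
    show ?thesis
    proof (cases "only_odd_below x (Suc t)")
      case True
      then have "odd (x ! i)" "x ! i \<le> t" if "i < length x" for i
        using nth_mem[OF that] by (auto simp: only_odd_below_def less_Suc_eq_le)
      then have "E = {..<length x}" using False unfolding E_def by auto
      then show ?thesis using le assms(1) True by (simp add: feasible_def)
    next
      case nall: False
      show ?thesis
      proof (cases "E = {}")
        case True
        \<comment> \<open>No odd pile is at most \<open>t\<close> and, by \<open>nex\<close>, no
          even pile is below it. Hence no pile falls short of \<open>t\<close>.\<close>
        then have "t - x ! i = 0" if "i < length x" for i
        proof -
          have "\<not> (x ! i \<le> t \<and> odd (x ! i))" using that True \<open>odd t\<close> by (auto simp: E_def)
          moreover have "\<not> (even (x ! i) \<and> x ! i < t)" using that nex by (auto simp: even_below_def)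
          ultimately show ?thesis by auto
        qed
        then show ?thesis by (simp add: feasible_def deficit_def)
      next
        case False
        then have "0 < card E" using E card_gt_0_iff by blast
        then show ?thesis unfolding feasible_def using le nall by simp
      qed
    qed
  qed
qed

lemma feasible_mono:
  assumes "2 \<le> length x" "feasible x t" "s \<le> t"
  shows "feasible x s"
  using assms(3,2) by (induction rule: inc_induct) (auto dest: feasible_Suc_imp[OF assms(1)])

text \<open>Two piles suffice: together their summands grow like \<open>t\<close>, the budget only
  like half of \<open>t\<close>. The bound yields a greatest feasible number, and the machine
  computes it to limit the search.\<close>

lemma feasible_le:
  assumes "2 \<le> length x" "feasible x t"
  shows "t \<le> sum_list x + 2"
proof -
  obtain a b x' where x: "x = a # b # x'"
    using assms(1) by (metis Suc_le_length_iff numeral_2_eq_2)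
  have "(t - a + 1) div 2 + (t - b + 1) div 2 \<le> deficit x t"
    unfolding deficit_def x by (simp add: sum.lessThan_Suc_shift del: sum.lessThan_Suc)
  also have "\<dots> \<le> t div 2 + 1" using assms(2) unfolding feasible_def of_bool_def by (auto split: if_splits)
  finally have "(t - a + 1) div 2 + (t - b + 1) div 2 \<le> t div 2 + 1" .
  moreover have "c \<le> 2 * ((c + 1) div 2)" for c :: nat by simp
  from this[of "t - a"] this[of "t - b"]
  have "t \<le> a + 2 * ((t - a + 1) div 2)" "t \<le> b + 2 * ((t - b + 1) div 2)" by linarith+
  moreover have "2 * (t div 2) \<le> t" by simp
  ultimately have "t \<le> a + b + 2" by linarith
  then show ?thesis by (simp add: x)
qed

definition keep :: "nat list \<Rightarrow> nat \<Rightarrow> nat list" where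
  "keep x j = map (\<lambda>i. if i = j then x ! i else x ! i - 1) [0..<length x]"

lemma nim_moves:
  assumes "0 < n" "length x = n"
  shows "nim n (n - 1) x = {keep x j | j. j < n \<and> (\<forall>i<n. i \<noteq> j \<longrightarrow> 0 < x ! i)}" (is "_ = ?R")
proof
  show "nim n (n - 1) x \<subseteq> ?R"
  proof
    fix y assume "y \<in> nim n (n - 1) x"
    then obtain S where S: "S \<subseteq> {..<n}" "card S = n - 1" "\<forall>i\<in>S. x ! i > 0"
      and y: "y = map (\<lambda>i. if i \<in> S then x ! i - 1 else x ! i) [0..<n]"
      unfolding nim_def by blast
    have "card ({..<n} - S) = 1" using S(1,2) assms(1) by (simp add: card_Diff_subset finite_subset)
    then obtain j where j: "{..<n} - S = {j}" by (auto simp: card_1_singleton_iff)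
    then have "i \<in> S \<longleftrightarrow> i \<noteq> j" if "i < n" for i using S(1) that by auto
    moreover have "j < n" using j by auto
    ultimately have "y = keep x j" "j < n" "\<forall>i<n. i \<noteq> j \<longrightarrow> 0 < x ! i"
      using S(3) assms(2) by (auto simp: y keep_def)
    then show "y \<in> ?R" by blast
  qed
  show "?R \<subseteq> nim n (n - 1) x"
  proof clarify
    fix j assume "j < n" "\<forall>i<n. i \<noteq> j \<longrightarrow> 0 < x ! i"
    then show "keep x j \<in> nim n (n - 1) x"
      unfolding nim_def using assms(2)
      by (intro CollectI exI[of _ "{..<n} - {j}"]) (auto simp: keep_def)
  qed
qed

text \<open>Lowering a pile and the target by one leaves the shortfall unchanged, provided that the
  pile is nonempty so that \<open>x ! i - 1\<close> is not truncated. The kept pile contributes the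
  increment of \<open>half_diff_Suc\<close>.\<close>

lemma deficit_keep:
  assumes "j < length x" "\<And>i. i < length x \<Longrightarrow> i \<noteq> j \<Longrightarrow> 0 < x ! i"
  shows "deficit x (Suc t) = deficit (keep x j) t + of_bool (x ! j \<le> t \<and> even (t + x ! j))"
proof -
  have "deficit x (Suc t) =
      (\<Sum>i<length x. (t - keep x j ! i + 1) div 2 + of_bool (i = j \<and> x ! j \<le> t \<and> even (t + x ! j)))"
    unfolding deficit_def
  proof (rule sum.cong[OF refl])
    fix i assume i: "i \<in> {..<length x}"
    show "(Suc t - x ! i + 1) div 2 =
        (t - keep x j ! i + 1) div 2 + of_bool (i = j \<and> x ! j \<le> t \<and> even (t + x ! j))"
    proof (cases "i = j")
      case True
      then show ?thesis using i half_diff_Suc[of t "x ! j"] by (simp add: keep_def)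
    next
      case False
      then obtain a where "x ! i = Suc a" using assms(2) i gr0_conv_Suc by auto
      then show ?thesis using i False by (simp add: keep_def)
    qed
  qed
  also have "\<dots> = deficit (keep x j) t +
      (\<Sum>i<length x. if i = j then of_bool (x ! j \<le> t \<and> even (t + x ! j)) else 0)"
    by (auto simp: sum.distrib deficit_def keep_def intro!: sum.cong)
  finally show ?thesis using assms(1) by simp
qed

section \<open>Feasibility before and after a legal move that keeps pile \<open>j\<close>\<close>

context
  fixes x :: "nat list" and j :: nat
  assumes len: "2 \<le> length x" and j: "j < length x"
    and pos: "\<And>i. i < length x \<Longrightarrow> i \<noteq> j \<Longrightarrow> 0 < x ! i"
begin

lemma length_keep: "length (keep x j) = length x"
  by (simp add: keep_def)

lemma keep_nth: "i < length x \<Longrightarrow> keep x j ! i = (if i = j then x ! j else x ! i - 1)"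
  by (simp add: keep_def)

lemma set_keep: "a \<in> set (keep x j) \<longleftrightarrow> a = x ! j \<or> (\<exists>i<length x. i \<noteq> j \<and> Suc a = x ! i)"
proof
  assume "a \<in> set (keep x j)"
  then obtain i where "i < length x" "a = keep x j ! i" by (auto simp: in_set_conv_nth length_keep)
  then show "a = x ! j \<or> (\<exists>i<length x. i \<noteq> j \<and> Suc a = x ! i)"
    using pos[of i] by (auto simp: keep_nth)
next
  assume "a = x ! j \<or> (\<exists>i<length x. i \<noteq> j \<and> Suc a = x ! i)"
  then obtain i where "i < length x" "a = keep x j ! i"
    using j by (metis diff_Suc_1 keep_nth)
  then show "a \<in> set (keep x j)" by (simp add: length_keep)
qed

lemma kept_mem: "x ! j \<in> set x" "x ! j \<in> set (keep x j)"
  using j by (auto simp: set_keep)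

text \<open>A lowered pile changes its parity. This carries a correction over between the conditions
  for even and for odd targets.\<close>

lemma other_pile:
  obtains b where "Suc b \<in> set x" "b \<in> set (keep x j)"
proof -
  obtain i where i: "i < length x" "i \<noteq> j"
    using len by (metis Suc_1 Suc_le_lessD less_trans zero_less_one zero_neq_one)
  then obtain b where "x ! i = Suc b" using pos gr0_conv_Suc by blast
  then show ?thesis using i that by (metis nth_mem set_keep)
qed

text \<open>Two ways to pay: if the successor uses its correction, a lowered pile was even before
  the move and earns the correction for \<open>x\<close>, while the kept pile is odd and costs
  nothing. Otherwise a kept pile that costs one is itself even and small and earns the correction.
  Consequently no successor of a position of even rank has the same or a larger rank.\<close>

lemma feasible_keep_even:
  assumes "even t" "feasible (keep x j) t"
  shows "feasible x (Suc t)"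
proof (cases "only_odd_below (keep x j) t")
  case True
  obtain b where b: "Suc b \<in> set x" "b \<in> set (keep x j)" by (rule other_pile)
  then have "even_below x (Suc t)"
    using only_odd_belowD[OF True b(2)] by (intro even_belowI[OF b(1)]) auto
  moreover have "odd (x ! j)" using only_odd_belowD[OF True kept_mem(2)] by simp
  ultimately show ?thesis
    using assms True by (simp add: feasible_def deficit_keep[OF j pos])
next
  case False
  then have "deficit (keep x j) t \<le> t div 2" using assms by (simp add: feasible_def)
  moreover have "of_bool (x ! j \<le> t \<and> even (t + x ! j)) \<le> (of_bool (even_below x (Suc t)) :: nat)"
    using assms(1) kept_mem by (auto simp: of_bool_def even_below_def less_Suc_eq_le)
  ultimately show ?thesis
    using assms(1) by (simp add: feasible_def deficit_keep[OF j pos])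
qed

text \<open>With \<open>t\<close> the even rank of the successor, this limits the rank of
  \<open>x\<close> to \<open>Suc t\<close>. If the successor has an even pile up to
  \<open>t\<close>, its correction is available at \<open>Suc t\<close>, and a correction used by
  \<open>x\<close> is offset by the odd kept pile. If not, its deficit does not grow from
  \<open>t\<close> to \<open>Suc t\<close>.\<close>

lemma feasible_keep_even_Suc:
  assumes "even t" "feasible (keep x j) t" "feasible x (Suc (Suc t))"
  shows "feasible (keep x j) (Suc t)"
proof -
  have x: "deficit (keep x j) (Suc t) + of_bool (x ! j \<le> Suc t \<and> odd (x ! j)) \<le>
      Suc (t div 2) + of_bool (only_odd_below x (Suc (Suc t)))"
    using assms(1,3) deficit_keep[OF j pos, of "Suc t"] by (simp add: feasible_def)
  show ?thesis
  proof (cases "even_below (keep x j) (Suc t)")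
    case True
    have "of_bool (only_odd_below x (Suc (Suc t))) \<le>
        (of_bool (x ! j \<le> Suc t \<and> odd (x ! j)) :: nat)"
      using kept_mem by (auto simp: of_bool_def only_odd_below_def less_Suc_eq_le)
    then have "deficit (keep x j) (Suc t) \<le> Suc (t div 2)" using x by linarith
    then show ?thesis using True assms(1) by (simp add: feasible_def)
  next
    case False
    then have "\<not> (keep x j ! i \<le> t \<and> even (keep x j ! i))" if "i < length (keep x j)" for i
      using nth_mem[OF that] by (auto simp: even_below_def less_Suc_eq_le)
    then have "{i. i < length (keep x j) \<and> keep x j ! i \<le> t \<and> even (t + keep x j ! i)} = {}"
      using assms(1) by auto
    then have eq: "deficit (keep x j) (Suc t) = deficit (keep x j) t" by (simp only: deficit_Suc card.empty)
    show ?thesis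
    proof (cases "only_odd_below (keep x j) t")
      case True
      obtain b where b: "Suc b \<in> set x" "b \<in> set (keep x j)" by (rule other_pile)
      then have "\<not> only_odd_below x (Suc (Suc t))" 
        using only_odd_belowD[OF True b(2)] only_odd_belowD[OF _ b(1)] by fastforce
      moreover have "x ! j \<le> Suc t \<and> odd (x ! j)"
        using only_odd_belowD[OF True kept_mem(2)] by simp
      ultimately show ?thesis using x assms(1) by (simp add: feasible_def)
    next
      case False
      then show ?thesis using assms(1,2) eq by (simp add: feasible_def)
    qed
  qed
qed

text \<open>Provides the move for even ranks. If the smallest pile exceeds \<open>t\<close>, nothing
  falls short. If it does not, an odd kept pile adds one to the deficit of \<open>x\<close>, and an
  even one earns the correction at the odd target \<open>t\<close>; if \<open>x\<close> uses its own
  correction, a lowered pile earns one for the successor.\<close>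

lemma feasible_keep_smallest:
  assumes "odd t" "feasible x (Suc t)" "\<And>a. a \<in> set x \<Longrightarrow> x ! j \<le> a"
  shows "feasible (keep x j) t"
proof (cases "x ! j \<le> t")
  case True
  have x: "deficit (keep x j) t + of_bool (odd (x ! j)) \<le>
      Suc (t div 2) + of_bool (only_odd_below x (Suc t))"
    using assms(1,2) True by (simp add: feasible_def deficit_keep[OF j pos])
  show ?thesis
  proof (cases "only_odd_below x (Suc t)")
    case all: True
    obtain b where b: "Suc b \<in> set x" "b \<in> set (keep x j)" by (rule other_pile)
    then have "even_below (keep x j) t" 
      using only_odd_belowD[OF all b(1)] by (intro even_belowI[OF b(2)]) auto
    moreover have "odd (x ! j)" using only_odd_belowD[OF all kept_mem(1)] by simp
    ultimately show ?thesis using x all assms(1) by (simp add: feasible_def)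
  next
    case False
    have "even_below (keep x j) t" if "even (x ! j)"
      using that True assms(1) by (intro even_belowI[OF kept_mem(2)]) (auto simp: order.strict_iff_order)
    then show ?thesis using x False assms(1) by (cases "odd (x ! j)") (auto simp: feasible_def)
  qed
next
  case False
  have "t - keep x j ! i = 0" if "i < length x" for i
    using False assms(3)[of "x ! i"] that by (auto simp: keep_nth)
  then show ?thesis by (simp add: feasible_def deficit_def length_keep)
qed

text \<open>By parity the kept pile costs one at \<open>Suc t\<close> and nothing at
  \<open>Suc (Suc t)\<close>. The former outweighs a correction of \<open>x\<close>; a correction of
  the successor is covered by the increase of the budget. Both parts together fix the rank of the
  successor when \<open>x\<close> has rank \<open>Suc t\<close>.\<close>

lemma feasible_keep_even_pile:
  assumes "even t" "even (x ! j)" "x ! j \<le> t"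
  shows "feasible x (Suc t) \<Longrightarrow> feasible (keep x j) t"
    and "feasible (keep x j) (Suc t) \<Longrightarrow> feasible x (Suc (Suc t))"
proof -
  have "of_bool b \<le> (1::nat)" for b by simp
  note le1 = this[of "even_below (keep x j) (Suc t)"] this[of "even_below x (Suc t)"]
  show "feasible (keep x j) t" if "feasible x (Suc t)"
    using that assms le1 deficit_keep[OF j pos] unfolding feasible_def by simp
  show "feasible x (Suc (Suc t))" if "feasible (keep x j) (Suc t)"
    using that assms le1 deficit_keep[OF j pos] unfolding feasible_def by simp
qed

text \<open>Here \<open>x\<close> has no correction at \<open>Suc t\<close>. At
  \<open>Suc (Suc t)\<close> the kept pile costs something only if it is at most
  \<open>Suc t\<close>; as it is a largest one, all piles are then odd and small, and
  \<open>x\<close> earns a correction that pays for it.\<close>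

lemma feasible_keep_largest:
  assumes "even t" "\<And>a. a \<in> set x \<Longrightarrow> even a \<Longrightarrow> t < a" "\<And>a. a \<in> set x \<Longrightarrow> a \<le> x ! j"
  shows "feasible x (Suc t) \<Longrightarrow> feasible (keep x j) t"
    and "feasible (keep x j) (Suc t) \<Longrightarrow> feasible x (Suc (Suc t))"
proof -
  have nex: "\<not> even_below x (Suc t)" using assms(2) by (fastforce simp: even_below_def)
  show "feasible (keep x j) t" if "feasible x (Suc t)"
    using that assms(1) nex deficit_keep[OF j pos] unfolding feasible_def by simp
  have "only_odd_below x (Suc (Suc t))" if "x ! j \<le> Suc t"
    unfolding only_odd_below_def
  proof
    fix a assume a: "a \<in> set x"
    then have "a \<le> Suc t" using assms(3) that le_trans by blast
    moreover have "even a \<Longrightarrow> t < a" using assms(2) a by blast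
    ultimately show "odd a \<and> a < Suc (Suc t)" using assms(1) by (cases "a = Suc t") auto
  qed
  then have "of_bool (even_below (keep x j) (Suc t)) + of_bool (x ! j \<le> Suc t \<and> odd (x ! j))
      \<le> Suc (of_bool (only_odd_below x (Suc (Suc t))))"
    by (auto simp: of_bool_def)
  then show "feasible x (Suc (Suc t))" if "feasible (keep x j) (Suc t)"
    using that assms(1) deficit_keep[OF j pos, of "Suc t"] unfolding feasible_def by simp
qed

end

text \<open>At target 1 the deficit counts the empty piles, and the budget is at most 1.\<close>

lemma feasible_1D:
  assumes "feasible x 1" "i < length x" "j < length x" "i \<noteq> j" "x ! i = 0"
  shows "0 < x ! j"
proof (rule ccontr)
  assume "\<not> 0 < x ! j"
  then have "{i, j} \<subseteq> {i. i < length x \<and> x ! i \<le> 0 \<and> even (0 + x ! i)}" using assms by auto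
  from card_mono[OF _ this] have "2 \<le> deficit x (Suc 0)"
    using assms(4) by (simp add: deficit_Suc)
  then show False using assms(1) by (auto simp: feasible_def of_bool_def split: if_splits)
qed

section \<open>The feasibility threshold and its identification with the remoteness\<close>

definition rank :: "nat list \<Rightarrow> nat" where
  "rank x = (GREATEST t. feasible x t)"

lemma feasible_iff:
  assumes "2 \<le> length x"
  shows "feasible x t \<longleftrightarrow> t \<le> rank x"
proof -
  have "feasible x (rank x)"
    unfolding rank_def using GreatestI_nat[of "feasible x"] feasible_0 feasible_le[OF assms] by blast
  moreover have "feasible x t \<Longrightarrow> t \<le> rank x"
    unfolding rank_def using Greatest_le_nat[of "feasible x"] feasible_le[OF assms] by blast
  ultimately show ?thesis using feasible_mono[OF assms] by blast
qed

text \<open>The bounds for all successors come from \<open>feasible_keep_even\<close> and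
  \<open>feasible_keep_even_Suc\<close>, which hold for every legal move. A successor of rank one
  less is found by keeping a smallest pile if the rank is even; if it is \<open>Suc t\<close> with
  \<open>t\<close> even, by keeping a smallest even pile if that is at most \<open>t\<close>, and a
  largest pile otherwise.\<close>

lemma remoteness_nim:
  assumes "2 \<le> length x"
  shows "remoteness (nim (length x) (length x - 1)) x = rank x"
proof (rule remoteness_eqI[where D = "{y. length y = length x}"])
  let ?N = "nim (length x) (length x - 1)"
  define legal where "legal = (\<lambda>z::nat list. \<lambda>j. j < length z \<and> (\<forall>i<length z. i \<noteq> j \<longrightarrow> 0 < z ! i))"
  have N: "?N z = {keep z j | j. legal z j}" if "length z = length x" for z
    using nim_moves[OF _ that] assms that unfolding legal_def by (metis gr0I not_numeral_le_zero)
  have len: "length (keep z j) = length z" for z j by (simp add: keep_def)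
  have rank_keep_even: "t < rank z" if "legal z j" "length z = length x" "even t" "t \<le> rank (keep z j)" for z j t
    using feasible_keep_even[of z j t] feasible_iff[of z] feasible_iff[of "keep z j"] that assms len
    by (auto simp: legal_def)
  have rank_keep_Suc: "rank z \<le> Suc (rank (keep z j))"
    if "legal z j" "length z = length x" "even (rank (keep z j))" for z j
  proof (rule ccontr)
    assume "\<not> ?thesis"
    then have "feasible z (Suc (Suc (rank (keep z j))))" "feasible (keep z j) (rank (keep z j))"
      using that assms len by (simp_all add: feasible_iff)
    then have "feasible (keep z j) (Suc (rank (keep z j)))"
      using feasible_keep_even_Suc[of z j "rank (keep z j)"] that assms by (auto simp: legal_def)
    then show False using that assms len by (simp add: feasible_iff)
  qed
  fix z y :: "nat list" assume "z \<in> {y. length y = length x}"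
  then have z: "length z = length x" by simp
  show "y \<in> {y. length y = length x}" if "y \<in> ?N z" using that z len N by auto
  show "odd (rank y) \<and> rank y < rank z" if y: "y \<in> ?N z" "even (rank z)"
  proof -
    obtain j where j: "legal z j" "y = keep z j" using y(1) N[OF z] by auto
    have "rank y < rank z"
    proof (rule ccontr)
      assume "\<not> ?thesis"
      then show False using rank_keep_even[OF j(1) z y(2)] j(2) by simp
    qed
    moreover from this have "odd (rank y)"
      using rank_keep_Suc[OF j(1) z] j(2) y(2) by (metis Suc_leI even_Suc le_antisym)
    ultimately show ?thesis by blast
  qed
  show "rank z \<le> Suc (rank y)" if "y \<in> ?N z" "odd (rank z)" "even (rank y)"
    using that N[OF z] rank_keep_Suc[OF _ z] by auto
  show "\<exists>y\<in>?N z. Suc (rank y) = rank z" if pos: "0 < rank z"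
  proof -
    have ne: "set z \<noteq> {}" using assms z by auto
    have "feasible z 1" using that assms z by (simp add: feasible_iff)
    note zero = feasible_1D[OF this]
    have "\<exists>j. legal z j \<and> Suc (rank (keep z j)) = rank z"
    proof (cases "even (rank z)")
      case True
      obtain t where t: "rank z = Suc t" using pos gr0_conv_Suc by blast
      have "Min (set z) \<in> set z" using ne by simp
      then obtain j where "j < length z" "z ! j = Min (set z)" unfolding in_set_conv_nth by blast
      then have j: "j < length z" "\<And>a. a \<in> set z \<Longrightarrow> z ! j \<le> a" by simp_all
      have l: "legal z j" unfolding legal_def
      proof (intro conjI allI impI j(1))
        fix i assume i: "i < length z" "i \<noteq> j"
        show "0 < z ! i" using zero[of i j] j(2)[OF nth_mem[OF i(1)]] i j(1) by (cases "z ! i") auto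
      qed
      have "t \<le> rank (keep z j)"
        using feasible_keep_smallest[of z j t] t True j l assms z len by (auto simp: feasible_iff legal_def)
      moreover have "\<not> rank z \<le> rank (keep z j)"
        using rank_keep_even[OF l z True] by blast
      ultimately show ?thesis using l t by auto
    next
      case False
      obtain t where t: "rank z = Suc t" "even t" using pos False gr0_conv_Suc by (metis even_Suc)
      have *: ?thesis if "legal z j" "feasible z (Suc t) \<Longrightarrow> feasible (keep z j) t"
        "feasible (keep z j) (Suc t) \<Longrightarrow> feasible z (Suc (Suc t))" for j
      proof -
        have "feasible (keep z j) t" "\<not> feasible (keep z j) (Suc t)"
          using that(2,3) t(1) assms z by (auto simp: feasible_iff)
        then have "rank (keep z j) = t" using assms z len by (simp add: feasible_iff)
        then show ?thesis using that(1) t(1) by auto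
      qed
      show ?thesis
      proof (cases "\<exists>a\<in>set z. even a \<and> a \<le> t")
        case True
        define a where "a = (LEAST a. a \<in> set z \<and> even a)"
        have a: "a \<in> set z" "even a" "\<And>b. b \<in> set z \<Longrightarrow> even b \<Longrightarrow> a \<le> b"
          using LeastI_ex[of "\<lambda>a. a \<in> set z \<and> even a"] Least_le[of "\<lambda>a. a \<in> set z \<and> even a"] True
          unfolding a_def by blast+
        then obtain j where j: "j < length z" "z ! j = a" by (metis in_set_conv_nth)
        \<comment> \<open>An empty pile is even, so if another pile were empty, the minimality of
          \<open>a\<close> would make pile \<open>j\<close> empty too, against
          \<open>zero\<close>.\<close>
        have l: "legal z j" unfolding legal_def
        proof (intro conjI allI impI j(1))
          fix i assume i: "i < length z" "i \<noteq> j"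
          show "0 < z ! i" using zero[of i j] i j a(3)[OF nth_mem[OF i(1)]] by (cases "z ! i") auto
        qed
        show ?thesis
        proof (rule *[OF l])
          have "a \<le> t" using True a(3) le_trans by blast
          note keep = feasible_keep_even_pile[of z j t, OF _ j(1) _ t(2)]
          show "feasible z (Suc t) \<Longrightarrow> feasible (keep z j) t"
            "feasible (keep z j) (Suc t) \<Longrightarrow> feasible z (Suc (Suc t))"
            using keep l assms z \<open>a \<le> t\<close> a(2) j(2) by (simp_all add: legal_def)
        qed
      next
        case False
        have "Max (set z) \<in> set z" using ne by simp
      then obtain j where "j < length z" "z ! j = Max (set z)" unfolding in_set_conv_nth by blast
      then have j: "j < length z" "\<And>a. a \<in> set z \<Longrightarrow> a \<le> z ! j" by simp_all
        have l: "legal z j" unfolding legal_def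
        proof (intro conjI allI impI j(1))
          fix i assume "i < length z"
          then have "\<not> (even (z ! i) \<and> z ! i \<le> t)" using False by auto
          then show "0 < z ! i" by (cases "z ! i") auto
        qed
        show ?thesis
        proof (rule *[OF l])
          have "t < a" if "a \<in> set z" "even a" for a using False that not_le by blast
          note keep = feasible_keep_largest[of z j t, OF _ j(1) _ t(2) this j(2)]
          show "feasible z (Suc t) \<Longrightarrow> feasible (keep z j) t"
            "feasible (keep z j) (Suc t) \<Longrightarrow> feasible z (Suc (Suc t))"
            using keep l assms z by (simp_all add: legal_def)
        qed
      qed
    qed
    then show ?thesis using N[OF z] by auto
  qed
qed simp

section \<open>Counting machine steps\<close>

inductive steps :: "program \<Rightarrow> nat \<Rightarrow> config \<Rightarrow> config \<Rightarrow> bool" for P where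
  steps_0: "steps P 0 c c"
| steps_Suc: "fst c < length P \<Longrightarrow> steps P m (exec (P ! fst c) c) c' \<Longrightarrow> steps P (Suc m) c c'"

lemma steps_trans: "steps P m c c' \<Longrightarrow> steps P m' c' c'' \<Longrightarrow> steps P (m + m') c c''"
  by (induction rule: steps.induct) (auto intro: steps.intros)

lemma bits_mono: "a \<le> b \<Longrightarrow> bits a \<le> bits b"
proof (induction b arbitrary: a rule: binary.induct)
  case (1 b)
  show ?case
  proof (cases "a < 2")
    case True
    then show ?thesis by (simp add: binary.simps[of a] binary.simps[of b])
  next
    case False
    then have "bits (a div 2) \<le> bits (b div 2)" using 1 by (intro 1) (auto intro: div_le_mono)
    then show ?thesis using False 1(2) by (simp add: binary.simps[of a] binary.simps[of b])
  qed
qed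

lemma bits_double: "bits (2 * b) \<le> Suc (bits b)"
  by (subst binary.simps) simp

text \<open>The bound is strict for input symbols because \<open>Read\<close> stores the symbol plus
  one.\<close>

definition bounded :: "nat \<Rightarrow> config \<Rightarrow> bool" where
  "bounded b = (\<lambda>(pc, X, u, v). (\<forall>i. X i \<le> b) \<and> (\<forall>a\<in>set u. a < b))"

definition consts_le :: "nat \<Rightarrow> program \<Rightarrow> bool" where
  "consts_le b P \<longleftrightarrow> (\<forall>i c. Const i c \<in> set P \<longrightarrow> c \<le> b)"

lemma bounded_exec:
  assumes "bounded b c" "consts_le b P" "i \<in> set P"
  shows "bounded (2 * b) (exec i c)"
proof -
  obtain pc X u v where c: "c = (pc, X, u, v)" by (metis surj_pair)
  have X: "X i \<le> b" for i using assms(1) by (simp add: bounded_def c)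
  have X2: "X i \<le> 2 * b" for i using X[of i] by simp
  have u: "a < 2 * b" if "a \<in> set u" for a using assms(1) that by (fastforce simp: bounded_def c)
  have tl: "a < 2 * b" if "a \<in> set (tl u)" for a using u list.set_sel(2)[of u] that by (cases u) auto
  have next_le: "next_symbol u \<le> 2 * b" using u by (cases u) (auto simp: Suc_le_eq)
  have "X j + X k \<le> 2 * b" "X j - X k \<le> 2 * b" for j k using X[of j] X[of k] by auto
  moreover have "k \<le> 2 * b" if "i = Const j k" for j k
    using assms(2,3) that by (fastforce simp: consts_le_def)
  ultimately show ?thesis
    using X2 u tl next_le by (cases i) (simp_all add: c bounded_def)
qed

lemma cost_le:
  assumes "bounded b c" "consts_le b P" "i \<in> set P"
  shows "cost i c \<le> 2 * bits b"
proof -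
  obtain pc X u v where c: "c = (pc, X, u, v)" by (metis surj_pair)
  have X: "bits (X i) \<le> bits b" for i using assms(1) by (simp add: bounded_def c bits_mono)
  have "next_symbol u \<le> b" using assms(1) by (cases u) (auto simp: bounded_def c Suc_le_eq)
  then have u: "bits (next_symbol u) \<le> bits b" by (rule bits_mono)
  have k: "bits k \<le> bits b" if "i = Const j k" for j k
    using assms(2,3) that by (intro bits_mono) (auto simp: consts_le_def)
  show ?thesis
  proof (cases i)
    case (Const j k)
    then show ?thesis using k by (simp add: c)
  next
    case (Add i j k)
    then show ?thesis using add_mono[OF X[of j] X[of k]] by (simp add: c)
  next
    case (Sub i j k)
    then show ?thesis using add_mono[OF X[of j] X[of k]] by (simp add: c)
  next
    case (Load i j)
    then show ?thesis using add_mono[OF X[of j] X[of "X j"]] by (simp add: c)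
  next
    case (Store i j)
    then show ?thesis using add_mono[OF X[of i] X[of j]] by (simp add: c)
  next
    case (Jump j l)
    then show ?thesis using X[of j] by (simp add: c)
  next
    case (Read j)
    then show ?thesis using u by (simp add: c)
  next
    case (Print j)
    then show ?thesis using X[of j] by (simp add: c)
  qed
qed

text \<open>A step at most doubles the largest number in sight, so the logarithmic cost of \<open>m\<close> steps
  is quadratic in \<open>m\<close>, and it suffices to count steps.\<close>

lemma run_of_steps:
  assumes "steps P m c c'" "bounded b c" "consts_le b P"
  shows "\<exists>t \<le> m * (2 * (bits b + m)). run P c t c'"
  using assms
proof (induction arbitrary: b rule: steps.induct)
  case (steps_0 c)
  show ?case using run_refl by auto
next
  case (steps_Suc c m c')
  have i: "P ! fst c \<in> set P" using steps_Suc.hyps(1) by simp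
  have "consts_le (2 * b) P" using steps_Suc.prems(2) by (fastforce simp: consts_le_def)
  then obtain t where t: "t \<le> m * (2 * (bits (2 * b) + m))" "run P (exec (P ! fst c) c) t c'"
    using steps_Suc.IH bounded_exec[OF steps_Suc.prems i] by blast
  have "run P c (cost (P ! fst c) c + t) c'"
    using run_step[OF steps_Suc.hyps(1) t(2)] .
  moreover have "cost (P ! fst c) c + t \<le> Suc m * (2 * (bits b + Suc m))"
  proof -
    have "t \<le> m * (2 * (bits b + Suc m))"
      using t(1) by (rule order_trans) (intro mult_le_mono, use bits_double[of b] in simp_all)
    then show ?thesis using cost_le[OF steps_Suc.prems i] by simp
  qed
  ultimately show ?case by blast
qed

section \<open>Structured programs\<close>

text \<open>The machine lacks an unconditional jump, and these constructs can be compiled without one: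
  \<open>Unless j c\<close> runs \<open>c\<close> if \<open>X\<^sub>j = 0\<close>, and \<open>Repeat c j\<close> runs \<open>c\<close> until \<open>X\<^sub>j = 0\<close>.\<close>

datatype com = Block "instr list" | Seq com com (infixr ";;" 60) | Unless nat com | Repeat com nat

type_synonym store = "(nat \<Rightarrow> nat) \<times> word \<times> word"

fun code_length :: "com \<Rightarrow> nat" where
  "code_length (Block is) = length is"
| "code_length (c ;; d) = code_length c + code_length d"
| "code_length (Unless j c) = Suc (code_length c)"
| "code_length (Repeat c j) = Suc (code_length c)"

fun code :: "nat \<Rightarrow> com \<Rightarrow> program" where
  "code a (Block is) = is"
| "code a (c ;; d) = code a c @ code (a + code_length c) d"
| "code a (Unless j c) = Jump j (Suc (a + code_length c)) # code (Suc a) c"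
| "code a (Repeat c j) = code a c @ [Jump j a]"

lemma length_code: "length (code a c) = code_length c"
  by (induction c arbitrary: a) auto

fun effect :: "instr \<Rightarrow> store \<Rightarrow> store" where
  "effect (Const i c) (X, u, v) = (X(i := c), u, v)"
| "effect (Add i j k) (X, u, v) = (X(i := X j + X k), u, v)"
| "effect (Sub i j k) (X, u, v) = (X(i := X j - X k), u, v)"
| "effect (Load i j) (X, u, v) = (X(i := X (X j)), u, v)"
| "effect (Store i j) (X, u, v) = (X(X i := X j), u, v)"
| "effect (Jump j l) (X, u, v) = (X, u, v)"
| "effect (Read i) (X, u, v) = (X(i := next_symbol u), tl u, v)"
| "effect (Print j) (X, u, v) = (X, u, v @ [X j])"

fun is_jump :: "instr \<Rightarrow> bool" where
  "is_jump (Jump j l) \<longleftrightarrow> True"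
| "is_jump _ \<longleftrightarrow> False"

lemma exec_eq_effect: "\<not> is_jump i \<Longrightarrow> exec i (pc, s) = (Suc pc, effect i s)"
  by (cases s; cases i) auto

inductive eval :: "com \<Rightarrow> nat \<Rightarrow> store \<Rightarrow> store \<Rightarrow> bool" where
  Block: "\<forall>i\<in>set is. \<not> is_jump i \<Longrightarrow> eval (Block is) (length is) s (fold effect is s)"
| Seq: "eval c m s s' \<Longrightarrow> eval d m' s' s'' \<Longrightarrow> eval (c ;; d) (m + m') s s''"
| Skip: "0 < fst s j \<Longrightarrow> eval (Unless j c) 1 s s"
| Unless: "fst s j = 0 \<Longrightarrow> eval c m s s' \<Longrightarrow> eval (Unless j c) (Suc m) s s'"
| Leave: "eval c m s s' \<Longrightarrow> fst s' j = 0 \<Longrightarrow> eval (Repeat c j) (Suc m) s s'"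
| Repeat: "eval c m s s' \<Longrightarrow> 0 < fst s' j \<Longrightarrow> eval (Repeat c j) m' s' s'' \<Longrightarrow>
    eval (Repeat c j) (Suc m + m') s s''"

lemma steps_1: "pc < length P \<Longrightarrow> steps P 1 (pc, s) (exec (P ! pc) (pc, s))"
  using steps_Suc[of "(pc, s)" P 0] steps_0 by simp

lemma steps_Block:
  assumes "\<forall>i\<in>set is. \<not> is_jump i"
  shows "steps (pre @ is @ post) (length is) (length pre, s) (length pre + length is, fold effect is s)"
  using assms
proof (induction "is" arbitrary: pre s)
  case (Cons i "is")
  have "steps ((pre @ [i]) @ is @ post) (length is) (length (pre @ [i]), effect i s)
      (length (pre @ [i]) + length is, fold effect is (effect i s))"
    using Cons by (intro Cons.IH) auto
  then have "steps (pre @ (i # is) @ post) (Suc (length is)) (length pre, s)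
      (length (pre @ [i]) + length is, fold effect is (effect i s))"
    using Cons.prems by (intro steps_Suc) (simp_all add: exec_eq_effect)
  then show ?case by simp
qed (simp add: steps_0)

text \<open>Jump targets are absolute, so code is tied to its address \<open>length pre\<close>.
  Arbitrary \<open>pre\<close> and \<open>post\<close> let the induction treat the neighbouring
  parts of a construct as surrounding code.\<close>

lemma steps_code:
  assumes "eval c m s s'"
  shows "steps (pre @ code (length pre) c @ post) m (length pre, s) (length pre + code_length c, s')"
  using assms
proof (induction arbitrary: pre post rule: eval.induct)
  case (Block "is" s)
  then show ?case by (simp add: steps_Block)
next
  case (Seq c m s s' d m' s'')
  let ?P = "pre @ code (length pre) (c ;; d) @ post"
  have "steps ?P m (length pre, s) (length pre + code_length c, s')"
    using Seq.IH(1)[of pre "code (length pre + code_length c) d @ post"] by simp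
  moreover have "steps ?P m' (length pre + code_length c, s') (length pre + code_length (c ;; d), s'')"
    using Seq.IH(2)[of "pre @ code (length pre) c" post] by (simp add: length_code add.assoc)
  ultimately show ?case by (rule steps_trans)
next
  case (Skip s j c)
  then show ?case
    using steps_1[of "length pre" "pre @ code (length pre) (Unless j c) @ post" s]
    by (cases s) simp
next
  case (Unless s j c m s')
  let ?P = "pre @ code (length pre) (Unless j c) @ post"
  have "steps ?P m (Suc (length pre), s) (length pre + code_length (Unless j c), s')"
    using Unless.IH[of "pre @ [Jump j (Suc (length pre + code_length c))]" post] by simp
  then show ?case using Unless.hyps(1) by (intro steps_Suc; cases s) simp_all
next
  case (Leave c m s s' j)
  let ?P = "pre @ code (length pre) (Repeat c j) @ post"
  have "steps ?P m (length pre, s) (length pre + code_length c, s')"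
    using Leave.IH[of pre "[Jump j (length pre)] @ post"] by simp
  moreover have "steps ?P 1 (length pre + code_length c, s') (length pre + code_length (Repeat c j), s')"
    using steps_1[of "length pre + code_length c" ?P s'] Leave.hyps(2)
    by (cases s') (simp add: length_code nth_append)
  ultimately show ?case using steps_trans by fastforce
next
  case (Repeat c m s s' j m' s'')
  let ?P = "pre @ code (length pre) (Repeat c j) @ post"
  have "steps ?P m (length pre, s) (length pre + code_length c, s')"
    using Repeat.IH(1)[of pre "[Jump j (length pre)] @ post"] by simp
  moreover have "steps ?P 1 (length pre + code_length c, s') (length pre, s')"
    using steps_1[of "length pre + code_length c" ?P s'] Repeat.hyps(2)
    by (cases s') (simp add: length_code nth_append)
  ultimately have "steps ?P (m + 1) (length pre, s) (length pre, s')" by (rule steps_trans)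
  from steps_trans[OF this Repeat.IH(2)] show ?case by simp
qed

section \<open>Total correctness with a bound on the number of steps\<close>

definition hoare :: "(store \<Rightarrow> bool) \<Rightarrow> com \<Rightarrow> nat \<Rightarrow> (store \<Rightarrow> bool) \<Rightarrow> bool" where
  "hoare P c m Q \<longleftrightarrow> (\<forall>s. P s \<longrightarrow> (\<exists>m' \<le> m. \<exists>s'. eval c m' s s' \<and> Q s'))"

lemma hoareE:
  assumes "hoare P c m Q" "P s"
  obtains m' s' where "m' \<le> m" "eval c m' s s'" "Q s'"
  using assms unfolding hoare_def by blast

lemma hoare_conseq:
  assumes "hoare P c m Q" "\<And>s. P' s \<Longrightarrow> P s" "\<And>s. Q s \<Longrightarrow> Q' s" "m \<le> m'"
  shows "hoare P' c m' Q'"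
  using assms unfolding hoare_def by (meson order_trans)

lemma hoare_Seq:
  assumes "hoare P c m Q" "hoare Q d m' R"
  shows "hoare P (c ;; d) (m + m') R"
  unfolding hoare_def
proof (intro allI impI)
  fix s assume "P s"
  then obtain k s' where k: "k \<le> m" "eval c k s s'" "Q s'" using assms(1) unfolding hoare_def by blast
  then obtain k' s'' where "k' \<le> m'" "eval d k' s' s''" "R s''" using assms(2) unfolding hoare_def by blast
  then show "\<exists>k\<le>m + m'. \<exists>s'. eval (c ;; d) k s s' \<and> R s'"
    using k eval.Seq add_mono by blast
qed

text \<open>The number \<open>N\<close> of passes is known beforehand and \<open>I\<close> is
  indexed by the completed passes; the loop register has to vanish exactly after the last one. The
  test follows the body, hence \<open>0 < N\<close>, and costs one step per pass.\<close>

lemma hoare_Repeat: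
  assumes "\<And>k. k < N \<Longrightarrow> hoare (I k) c m (\<lambda>s. I (Suc k) s \<and> (0 < fst s j \<longleftrightarrow> Suc k < N))" "0 < N"
  shows "hoare (I 0) (Repeat c j) (N * Suc m) (I N)"
proof -
  have "\<exists>m' \<le> i * Suc m. \<exists>s'. eval (Repeat c j) m' s s' \<and> I N s'"
    if "0 < i" "k + i = N" "I k s" for i k s
    using that
  proof (induction i arbitrary: k s)
    case (Suc i)
    then have "k < N" by simp
    obtain m1 s1
      where "m1 \<le> m" "eval c m1 s s1" "I (Suc k) s1 \<and> (0 < fst s1 j \<longleftrightarrow> Suc k < N)"
      by (rule hoareE[OF assms(1)[OF \<open>k < N\<close>] Suc.prems(3)])
    then have 1: "m1 \<le> m" "eval c m1 s s1" "I (Suc k) s1" "0 < fst s1 j \<longleftrightarrow> Suc k < N"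
      by simp_all
    show ?case
    proof (cases "i = 0")
      case True
      then have "eval (Repeat c j) (Suc m1) s s1" "I N s1"
        using 1 Suc.prems eval.Leave[OF 1(2)] by auto
      moreover have "Suc m1 \<le> Suc i * Suc m" using 1(1) by simp
      ultimately show ?thesis by blast
    next
      case False
      then have "0 < i" "Suc k + i = N" using Suc.prems(2) by simp_all
      then obtain m2 s2 where 2: "m2 \<le> i * Suc m" "eval (Repeat c j) m2 s1 s2" "I N s2"
        using Suc.IH[of "Suc k" s1] 1(3) by blast
      then have "eval (Repeat c j) (Suc m1 + m2) s s2"
        using 1 False Suc.prems(2) eval.Repeat[OF 1(2)] by simp
      moreover have "Suc m1 + m2 \<le> Suc i * Suc m" using 1(1) 2(1) by simp
      ultimately show ?thesis using 2(3) by blast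
    qed
  qed simp
  from this[OF assms(2) add_0] show ?thesis unfolding hoare_def by blast
qed

lemma halts_with_hoare:
  assumes "hoare (\<lambda>s. s = (\<lambda>_. 0, w, [])) c m (\<lambda>(X, u, v). v = out)"
    and "consts_le b (code 0 c)" "\<forall>a\<in>set w. a < b"
  shows "\<exists>t \<le> m * (2 * (bits b + m)). halts_with (code 0 c) w out t"
proof -
  obtain k X u where k: "k \<le> m" "eval c k (\<lambda>_. 0, w, []) (X, u, out)"
    using assms(1) unfolding hoare_def by auto
  have "steps (code 0 c) k (0, \<lambda>_. 0, w, []) (code_length c, X, u, out)"
    using steps_code[OF k(2), of "[]" "[]"] by simp
  moreover have "bounded b (0, \<lambda>_. 0, w, [])" using assms(3) by (simp add: bounded_def)
  ultimately obtain t where "t \<le> k * (2 * (bits b + k))"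
      "run (code 0 c) (0, \<lambda>_. 0, w, []) t (code_length c, X, u, out)"
    using run_of_steps assms(2) by blast
  moreover have "k * (2 * (bits b + k)) \<le> m * (2 * (bits b + m))"
    using k(1) by (intro mult_le_mono) auto
  moreover have "code_length c \<ge> length (code 0 c)" by (simp add: length_code)
  ultimately show ?thesis unfolding halts_with_def by (meson order_trans)
qed

fun wp :: "com \<Rightarrow> (store \<Rightarrow> bool) \<Rightarrow> store \<Rightarrow> bool" where
  "wp (Block is) Q s \<longleftrightarrow> (\<forall>i\<in>set is. \<not> is_jump i) \<and> Q (fold effect is s)"
| "wp (c ;; d) Q s \<longleftrightarrow> wp c (wp d Q) s"
| "wp (Unless j c) Q s \<longleftrightarrow> (if fst s j = 0 then wp c Q s else Q s)"
| "wp (Repeat c j) Q s \<longleftrightarrow> False"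

text \<open>Without loops all jumps go forward, so no instruction is executed twice.
  \<open>wp\<close> is false on \<open>Repeat\<close>, which leaves loops to
  \<open>hoare_Repeat\<close>.\<close>

lemma eval_of_wp: "wp c Q s \<Longrightarrow> \<exists>m \<le> code_length c. \<exists>s'. eval c m s s' \<and> Q s'"
proof (induction c arbitrary: Q s)
  case (Block "is")
  then show ?case using eval.Block[of "is" s] by (metis code_length.simps(1) le_refl wp.simps(1))
next
  case (Seq c d)
  then have "wp c (wp d Q) s" by simp
  then obtain m s' where 1: "m \<le> code_length c" "eval c m s s'" "wp d Q s'" using Seq.IH(1) by blast
  then obtain m' s'' where 2: "m' \<le> code_length d" "eval d m' s' s''" "Q s''" using Seq.IH(2) by blast
  then have "m + m' \<le> code_length (c ;; d)" using 1 by simp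
  with eval.Seq[OF 1(2) 2(2)] 2(3) show ?case by blast
next
  case (Unless j c)
  show ?case
  proof (cases "fst s j = 0")
    case True
    then have "wp c Q s" using Unless.prems by simp
    then obtain m s' where "m \<le> code_length c" "eval c m s s'" "Q s'" using Unless.IH by blast
    then show ?thesis using eval.Unless[OF True] by (metis Suc_le_mono code_length.simps(3))
  next
    case False
    then show ?thesis using Unless.prems eval.Skip[of s j c]
      by (metis gr0I le_add1 plus_1_eq_Suc code_length.simps(3) wp.simps(3))
  qed
qed simp

lemma hoare_wp: "(\<And>s. P s \<Longrightarrow> wp c Q s) \<Longrightarrow> hoare P c (code_length c) Q"
  unfolding hoare_def using eval_of_wp by blast

lemma hoare_wp_Seq:
  assumes "\<And>s. P s \<Longrightarrow> wp c Q s" "hoare Q d m R"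
  shows "hoare P (c ;; d) (code_length c + m) R"
  by (rule hoare_Seq[OF hoare_wp assms(2)]) (rule assms(1))

lemma hoare_Seq_wp:
  assumes "hoare P c m Q" "\<And>s. Q s \<Longrightarrow> wp d R s"
  shows "hoare P (c ;; d) (m + code_length d) R"
  by (rule hoare_Seq[OF assms(1) hoare_wp]) (rule assms(2))

text \<open>Serves as a frame condition: \<open>R\<close> lists the registers that a program may
  overwrite.\<close>

definition agree :: "nat set \<Rightarrow> (nat \<Rightarrow> nat) \<Rightarrow> (nat \<Rightarrow> nat) \<Rightarrow> bool" where
  "agree R X Y \<longleftrightarrow> (\<forall>i. i \<notin> R \<longrightarrow> X i = Y i)"

lemma agree_refl [simp]: "agree R X X"
  by (simp add: agree_def)

lemma agree_upd [simp]: "agree R X Y \<Longrightarrow> i \<in> R \<Longrightarrow> agree R (X(i := a)) Y"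
  by (auto simp: agree_def)

lemma agreeD: "agree R X Y \<Longrightarrow> i \<notin> R \<Longrightarrow> X i = Y i"
  by (simp add: agree_def)

text \<open>\<open>Add\<close> and \<open>Sub\<close> have only register operands. Adding register 0
  copies, register 1 serves to count, and registers 2 and 3 classify input symbols.\<close>

definition constants :: "(nat \<Rightarrow> nat) \<Rightarrow> bool" where
  "constants X \<longleftrightarrow> X 0 = 0 \<and> X 1 = 1 \<and> X 2 = 2 \<and> X 3 = 3"

lemma constants_agree: "agree R X Y \<Longrightarrow> R \<inter> {0..3} = {} \<Longrightarrow> constants Y \<Longrightarrow> constants X"
proof -
  assume *: "agree R X Y" "R \<inter> {0..3} = {}" "constants Y"
  have "X i = Y i" if "i \<le> 3" for i
  proof -
    have "i \<notin> R" using *(2) that by (meson atLeastAtMost_iff disjoint_iff zero_le)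
    then show ?thesis using *(1) by (simp add: agree_def)
  qed
  then show "constants X" using *(3) by (simp add: constants_def)
qed

section \<open>Reading the input\<close>

definition val :: "word \<Rightarrow> nat" where
  "val ds = foldl (\<lambda>v d. 2 * v + d) 0 ds"

lemma val_simps [simp]: "val [] = 0" "val (ds @ [d]) = 2 * val ds + d"
  by (simp_all add: val_def)

lemma val_binary: "val (binary a) = a"
proof (induction a rule: binary.induct)
  case (1 a)
  then show ?case
    using val_simps(2)[of "[]" a] by (subst binary.simps) (auto simp del: val_simps(1) simp: val_def)
qed

lemma digit_binary: "d \<in> set (binary a) \<Longrightarrow> d < 2"
proof (induction a rule: binary.induct)
  case (1 a)
  then show ?case by (subst (asm) binary.simps) (auto split: if_splits)
qed

text \<open>\<open>X\<^sub>6\<close> receives the number, \<open>X\<^sub>7\<close> its half and \<open>X\<^sub>8\<close> its parity, which the machine could not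
  compute from the number without a division.\<close>

definition read_digit :: com where
  "read_digit = Block [Read 4, Sub 5 4 2] ;; Unless 5 (Block [Add 7 6 0, Add 6 6 6, Sub 8 4 1, Add 6 6 8]) ;;
     Block [Sub 5 3 4]"

definition read_number :: com where
  "read_number = Block [Const 6 0, Const 7 0, Const 8 0] ;; Repeat read_digit 5"

text \<open>A digit \<open>d\<close> arrives as \<open>d + 1\<close> and the separator as 3, so
  \<open>X 4 - 2\<close> vanishes on digits and \<open>3 - X 4\<close> on the separator. The old
  value is half of the new one. The additional pass in \<open>Suc (length ds)\<close> consumes the
  separator; a pass costs eight instructions and the loop jump.\<close>

lemma hoare_read_number:
  assumes "constants X0" "\<forall>d\<in>set ds. d < 2"
  shows "hoare (\<lambda>s. s = (X0, ds @ 2 # rest, v0)) read_number (3 + Suc (length ds) * 9)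
    (\<lambda>(X, u, v). u = rest \<and> v = v0 \<and> agree {4..8} X X0 \<and>
       X 6 = val ds \<and> X 7 = val ds div 2 \<and> X 8 = val ds mod 2)"
proof -
  define I where "I = (\<lambda>k (X, u, v). u = drop k (ds @ [2]) @ rest \<and> v = v0 \<and> agree {4..8} X X0 \<and>
    X 6 = val (take k ds) \<and> X 7 = val (take k ds) div 2 \<and> X 8 = val (take k ds) mod 2)"
  have step: "hoare (I k) read_digit (code_length read_digit)
      (\<lambda>s. I (Suc k) s \<and> (0 < fst s 5 \<longleftrightarrow> Suc k < Suc (length ds)))" if "k < Suc (length ds)" for k
  proof (rule hoare_wp)
    fix s assume "I k s"
    then obtain X where s: "s = (X, drop k (ds @ [2]) @ rest, v0)" and X: "agree {4..8} X X0"
      "X 6 = val (take k ds)" "X 7 = val (take k ds) div 2" "X 8 = val (take k ds) mod 2"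
      by (cases s) (auto simp: I_def)
    have c: "X 0 = 0" "X (Suc 0) = 1" "X 2 = 2" "X 3 = 3"
      using constants_agree[OF X(1) _ assms(1)] by (auto simp: constants_def)
    show "wp read_digit (\<lambda>s. I (Suc k) s \<and> (0 < fst s 5 \<longleftrightarrow> Suc k < Suc (length ds))) s"
    proof (cases "k < length ds")
      case True
      then have u: "drop k ds = ds ! k # drop (Suc k) ds" by (simp add: Cons_nth_drop_Suc)
      have t: "take (Suc k) ds = take k ds @ [ds ! k]" using True by (simp add: take_Suc_conv_app_nth)
      have "ds ! k = 0 \<or> ds ! k = 1" using assms(2) True nth_mem[OF True] by fastforce
      then show ?thesis
        using X c True by (auto simp: s u read_digit_def I_def t)
    next
      case False
      then have k: "k = length ds" using that by simp
      show ?thesis using X c by (auto simp: s k read_digit_def I_def)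
    qed
  qed
  have "hoare (\<lambda>s. s = (X0, ds @ 2 # rest, v0)) read_number
      (code_length (Block [Const 6 0, Const 7 0, Const 8 0]) + Suc (length ds) * Suc (code_length read_digit))
      (I (Suc (length ds)))"
    unfolding read_number_def
    by (rule hoare_wp_Seq[OF _ hoare_Repeat[OF step]]) (auto simp: I_def)
  then show ?thesis
    by (rule hoare_conseq) (auto simp: I_def read_digit_def)
qed

text \<open>\<open>X\<^sub>0, \<dots>, X\<^sub>3\<close> hold their own indices, \<open>X\<^sub>9\<close> the number of piles and \<open>X\<^bsub>10\<^esub>\<close> a stack pointer. The stack
  starts at address 30 with the half and the parity of every pile; powers of two are pushed on top
  of them later. \<open>X\<^bsub>12\<^esub>\<close> is \<open>2\<close> plus the number of stones, which is a bound for the remoteness.\<close>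

definition piles :: "nat list \<Rightarrow> (nat \<Rightarrow> nat) \<Rightarrow> bool" where
  "piles x X \<longleftrightarrow> (\<forall>k<length x. X (30 + 2 * k) = x ! k div 2 \<and> X (Suc (30 + 2 * k)) = x ! k mod 2)"

definition loaded :: "nat list \<Rightarrow> (nat \<Rightarrow> nat) \<Rightarrow> bool" where
  "loaded x X \<longleftrightarrow> constants X \<and> X 9 = length x \<and> piles x X"

definition store_number :: com where
  "store_number = Block [Store 10 7, Add 10 10 1, Store 10 8, Add 10 10 1, Add 12 12 6, Sub 11 11 1]"

definition read_position :: com where
  "read_position = Block [Const 1 1, Const 2 2, Const 3 3] ;; read_number ;;
     Block [Add 9 6 0, Add 11 6 0, Const 10 30, Const 12 2] ;; Repeat (read_number ;; store_number) 11"

definition read_inv :: "nat list \<Rightarrow> nat \<Rightarrow> store \<Rightarrow> bool" where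
  "read_inv x k = (\<lambda>(X, u, v). u = concat (map (\<lambda>a. binary a @ [2]) (drop k x)) \<and> v = [] \<and>
     constants X \<and> X 9 = length x \<and> piles (take k x) X \<and> X 10 = 30 + 2 * k \<and> X 11 = length x - k \<and>
     X 12 = 2 + sum_list (take k x))"

lemma hoare_read_pile:
  assumes "k < length x" "bits (x ! k) \<le> L"
  shows "hoare (read_inv x k) (read_number ;; store_number) (18 + 9 * L)
    (\<lambda>s. read_inv x (Suc k) s \<and> (0 < fst s 11 \<longleftrightarrow> Suc k < length x))"
  unfolding hoare_def
proof (intro allI impI)
  let ?rest = "concat (map (\<lambda>a. binary a @ [2]) (drop (Suc k) x))"
  fix s assume s: "read_inv x k s"
  obtain X0 u0 v0 where s0: "s = (X0, u0, v0)" by (cases s)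
  have inv: "u0 = binary (x ! k) @ 2 # ?rest" "v0 = []" "constants X0" "X0 9 = length x"
    "piles (take k x) X0" "X0 10 = 30 + 2 * k" "X0 11 = length x - k" "X0 12 = 2 + sum_list (take k x)"
    using s assms(1) by (simp_all add: read_inv_def s0 flip: Cons_nth_drop_Suc)
  have run: "hoare (\<lambda>s. s = (X0, u0, v0)) (read_number ;; store_number)
      (3 + Suc (bits (x ! k)) * 9 + code_length store_number)
      (\<lambda>s. read_inv x (Suc k) s \<and> (0 < fst s 11 \<longleftrightarrow> Suc k < length x))"
  proof (rule hoare_Seq_wp)
    show "hoare (\<lambda>s. s = (X0, u0, v0)) read_number (3 + Suc (bits (x ! k)) * 9)
        (\<lambda>(X, u, v). u = ?rest \<and> v = v0 \<and> agree {4..8} X X0 \<and>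
           X 6 = x ! k \<and> X 7 = x ! k div 2 \<and> X 8 = x ! k mod 2)"
      using hoare_read_number[OF inv(3), of "binary (x ! k)" ?rest v0] digit_binary
      by (simp add: val_binary inv(1))
  next
    fix s assume "case s of (X, u, v) \<Rightarrow> u = ?rest \<and> v = v0 \<and> agree {4..8} X X0 \<and>
        X 6 = x ! k \<and> X 7 = x ! k div 2 \<and> X 8 = x ! k mod 2"
    then obtain X where s: "s = (X, ?rest, [])" and X: "agree {4..8} X X0"
      "X 6 = x ! k" "X 7 = x ! k div 2" "X 8 = x ! k mod 2"
      using inv(2) by (cases s) auto
    have c: "constants X" using constants_agree[OF X(1) _ inv(3)] by auto
    then have c1: "X (Suc 0) = 1" by (simp add: constants_def)
    have r: "X 9 = length x" "X 10 = 30 + 2 * k" "X 11 = length x - k" "X 12 = 2 + sum_list (take k x)"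
      using agreeD[OF X(1)] inv by auto
    have p: "piles (take k x) X"
      using inv(5) agreeD[OF X(1)] by (simp add: piles_def)
    define X' where "X' = fst (fold effect
      [Store 10 7, Add 10 10 1, Store 10 8, Add 10 10 1, Add 12 12 6, Sub 11 11 1] s)"
    have X': "X' = X(30 + 2 * k := x ! k div 2, Suc (30 + 2 * k) := x ! k mod 2, 10 := 30 + 2 * Suc k,
        12 := 2 + sum_list (take (Suc k) x), 11 := length x - Suc k)"
      using X r c1 assms(1) by (auto simp: X'_def s fun_eq_iff take_Suc_conv_app_nth)
    have "piles (take (Suc k) x) X'"
      using p assms(1) by (auto simp: piles_def X' less_Suc_eq)
    moreover have "constants X'" using c by (simp add: constants_def X')
    moreover have "fold effect [Store 10 7, Add 10 10 1, Store 10 8, Add 10 10 1, Add 12 12 6, Sub 11 11 1] s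
        = (X', ?rest, [])"
      unfolding X'_def s by simp
    ultimately show "wp store_number (\<lambda>s. read_inv x (Suc k) s \<and> (0 < fst s 11 \<longleftrightarrow> Suc k < length x)) s"
      using assms(1) r unfolding store_number_def wp.simps by (auto simp: read_inv_def X')
  qed
  obtain m' s' where m': "m' \<le> 3 + Suc (bits (x ! k)) * 9 + code_length store_number"
    and s': "eval (read_number ;; store_number) m' s s'"
      "read_inv x (Suc k) s' \<and> (0 < fst s' 11 \<longleftrightarrow> Suc k < length x)"
    unfolding s0 by (rule hoareE[OF run refl])
  have "m' \<le> 18 + 9 * L"
    using m' assms(2) by (simp add: store_number_def)
  with s' show "\<exists>m'\<le>18 + 9 * L. \<exists>s'. eval (read_number ;; store_number) m' s s' \<and>
      (read_inv x (Suc k) s' \<and> (0 < fst s' 11 \<longleftrightarrow> Suc k < length x))"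
    by (intro exI[of _ m'] exI[of _ s'] conjI) simp_all
qed

lemma hoare_read_position:
  assumes "0 < length x" "\<And>a. a \<in> set x \<Longrightarrow> bits a \<le> L" "bits (length x) \<le> L"
  shows "hoare (\<lambda>s. s = (\<lambda>_. 0, encode_position (length x, x), [])) read_position
    (19 + 9 * L + length x * (19 + 9 * L))
    (\<lambda>(X, u, v). v = [] \<and> loaded x X \<and> X 10 = 30 + 2 * length x \<and> X 12 = 2 + sum_list x)"
proof -
  let ?n = "length x"
  let ?rest = "concat (map (\<lambda>a. binary a @ [2]) x)"
  let ?X0 = "(\<lambda>_. 0)(1 := 1, 2 := 2, 3 := 3 :: nat)"
  have X0: "constants ?X0" by (simp add: constants_def)
  have loop: "hoare (read_inv x 0) (Repeat (read_number ;; store_number) 11) (?n * Suc (18 + 9 * L)) (read_inv x ?n)"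
    by (rule hoare_Repeat[OF hoare_read_pile assms(1)]) (use assms(2) in auto)
  have head: "hoare (\<lambda>s. s = (?X0, binary ?n @ 2 # ?rest, [])) read_number (3 + Suc (bits ?n) * 9)
      (\<lambda>(X, u, v). u = ?rest \<and> v = [] \<and> agree {4..8} X ?X0 \<and> X 6 = ?n \<and> X 7 = ?n div 2 \<and> X 8 = ?n mod 2)"
    using hoare_read_number[OF X0, of "binary ?n" ?rest "[]"] digit_binary by (simp add: val_binary)
  have mid: "wp (Block [Add 9 6 0, Add 11 6 0, Const 10 30, Const 12 2]) (read_inv x 0) s"
    if s: "(\<lambda>(X, u, v). u = ?rest \<and> v = [] \<and> agree {4..8} X ?X0 \<and>
      X 6 = ?n \<and> X 7 = ?n div 2 \<and> X 8 = ?n mod 2) s" for s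
  proof -
    obtain X where s: "s = (X, ?rest, [])" and X: "agree {4..8} X ?X0" "X 6 = ?n"
      using s by (cases s) auto
    have "constants X" using constants_agree[OF X(1) _ X0] by auto
    then show ?thesis using X(2) by (simp add: s read_inv_def constants_def piles_def)
  qed
  have "hoare (\<lambda>s. s = (\<lambda>_. 0, encode_position (?n, x), [])) read_position
      (code_length (Block [Const 1 1, Const 2 2, Const 3 3]) + (3 + Suc (bits ?n) * 9 +
       (code_length (Block [Add 9 6 0, Add 11 6 0, Const 10 30, Const 12 2]) + ?n * Suc (18 + 9 * L))))
      (read_inv x ?n)"
    unfolding read_position_def
    by (rule hoare_wp_Seq[OF _ hoare_Seq[OF head hoare_wp_Seq[OF mid loop]]])
      (simp_all add: encode_position_def)
  then show ?thesis
    by (rule hoare_conseq) (use assms(3) in \<open>auto simp: read_inv_def loaded_def\<close>)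
qed

text \<open>Fixing the initial state allows the intermediate assertions to refer to its
  registers.\<close>

lemma hoare_pointwise: "(\<And>s. P s \<Longrightarrow> hoare (\<lambda>s'. s' = s) c m Q) \<Longrightarrow> hoare P c m Q"
  unfolding hoare_def by blast

lemma loaded_agree:
  assumes "agree R X Y" "R \<subseteq> {4..<30} - {9}" "loaded x Y"
  shows "loaded x X"
proof -
  have "X i = Y i" if "i < 4 \<or> i = 9 \<or> 30 \<le> i" for i
  proof -
    have "i \<notin> R" using assms(2) that by fastforce
    then show ?thesis using assms(1) by (rule agreeD[rotated])
  qed
  then show ?thesis using assms(3) by (simp add: loaded_def constants_def piles_def)
qed

section \<open>Testing feasibility\<close>

definition scan :: "com \<Rightarrow> com" where
  "scan body = Block [Const 16 0, Const 17 0, Const 18 30, Add 11 9 0] ;;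
     Repeat (Block [Load 19 18, Add 18 18 1, Load 8 18, Add 18 18 1] ;; body ;; Block [Sub 11 11 1]) 11"

definition scratch :: "nat set" where
  "scratch = {5, 8, 11, 16, 17, 18, 19, 20, 22}"

text \<open>The condition on \<open>body\<close> quantifies over the postcondition, so that it can
  be used with the rest of the pass as continuation. A pass adds four instructions to fetch a pile,
  one to count and the loop jump.\<close>

lemma hoare_scan:
  assumes X0: "loaded x X0" and "0 < length x"
    and body: "\<And>k X Q. k < length x \<Longrightarrow> agree scratch X X0 \<Longrightarrow>
      X 19 = x ! k div 2 \<Longrightarrow> X 8 = x ! k mod 2 \<Longrightarrow>
      (\<And>X'. agree scratch X' X0 \<Longrightarrow> X' 11 = X 11 \<Longrightarrow> X' 18 = X 18 \<Longrightarrow> X' 16 = X 16 + \<alpha> (x ! k) \<Longrightarrow>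
        X' 17 = (if \<gamma> (x ! k) then 1 else X 17) \<Longrightarrow> Q (X', u0, v0)) \<Longrightarrow>
      wp body Q (X, u0, v0)"
  shows "hoare (\<lambda>s. s = (X0, u0, v0)) (scan body) (4 + length x * (code_length body + 6))
    (\<lambda>(X, u, v). u = u0 \<and> v = v0 \<and> agree scratch X X0 \<and>
       X 16 = (\<Sum>k<length x. \<alpha> (x ! k)) \<and> X 17 = of_bool (\<exists>a\<in>set x. \<gamma> a))"
proof -
  let ?n = "length x"
  define fetch where "fetch = [Load 19 18, Add 18 18 1, Load 8 18, Add 18 18 1]"
  define I where "I = (\<lambda>k (X, u, v). u = u0 \<and> v = v0 \<and> agree scratch X X0 \<and> X 18 = 30 + 2 * k \<and>
    X 11 = ?n - k \<and> X 16 = (\<Sum>i<k. \<alpha> (x ! i)) \<and> X 17 = of_bool (\<exists>i<k. \<gamma> (x ! i)))"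
  have step: "hoare (I k) (Block fetch ;; body ;; Block [Sub 11 11 1])
      (code_length (Block fetch ;; body ;; Block [Sub 11 11 1]))
      (\<lambda>s. I (Suc k) s \<and> (0 < fst s 11 \<longleftrightarrow> Suc k < ?n))" (is "hoare _ _ _ ?Q") if "k < ?n" for k
  proof (rule hoare_wp)
    fix s assume "I k s"
    then obtain X where s: "s = (X, u0, v0)" and X: "agree scratch X X0" "X 18 = 30 + 2 * k" "X 11 = ?n - k"
      "X 16 = (\<Sum>i<k. \<alpha> (x ! i))" "X 17 = of_bool (\<exists>i<k. \<gamma> (x ! i))"
      by (cases s) (auto simp: I_def)
    have l: "loaded x X" using loaded_agree[OF X(1) _ X0] by (simp add: scratch_def)
    have one: "X (Suc 0) = 1" using l by (simp add: loaded_def constants_def)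
    have cells: "X (30 + 2 * k) = x ! k div 2" "X (Suc (30 + 2 * k)) = x ! k mod 2"
      using l that unfolding loaded_def piles_def by blast+
    define X1 where "X1 = X(19 := x ! k div 2, 18 := 30 + 2 * Suc k, 8 := x ! k mod 2)"
    have "fold effect fetch s = (X1, u0, v0)"
      using X(2) one cells by (simp add: fetch_def s X1_def fun_upd_twist)
    moreover have "\<forall>i\<in>set fetch. \<not> is_jump i" by (simp add: fetch_def)
    moreover have "wp body (wp (Block [Sub 11 11 1]) ?Q) (X1, u0, v0)"
    proof (rule body[OF that])
      show "agree scratch X1 X0" using X(1) by (simp add: X1_def scratch_def)
    next
      fix X' assume X': "agree scratch X' X0" "X' 11 = X1 11" "X' 18 = X1 18" "X' 16 = X1 16 + \<alpha> (x ! k)"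
        "X' 17 = (if \<gamma> (x ! k) then 1 else X1 17)"
      have "loaded x X'" using loaded_agree[OF X'(1) _ X0] by (simp add: scratch_def)
      then have one': "X' (Suc 0) = 1" by (simp add: loaded_def constants_def)
      have "agree scratch (X'(11 := a)) X0" for a using X'(1) by (simp add: scratch_def)
      moreover have "(\<exists>i<Suc k. \<gamma> (x ! i)) \<longleftrightarrow> \<gamma> (x ! k) \<or> (\<exists>i<k. \<gamma> (x ! i))"
        by (auto simp: less_Suc_eq)
      ultimately show "wp (Block [Sub 11 11 1]) ?Q (X', u0, v0)"
        using X' X that one' by (simp add: I_def X1_def)
    qed (simp_all add: X1_def)
    ultimately show "wp (Block fetch ;; body ;; Block [Sub 11 11 1]) ?Q s" by simp
  qed
  have "hoare (\<lambda>s. s = (X0, u0, v0)) (scan body)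
      (code_length (Block [Const 16 0, Const 17 0, Const 18 30, Add 11 9 0]) +
       ?n * Suc (code_length (Block fetch ;; body ;; Block [Sub 11 11 1]))) (I ?n)"
    unfolding scan_def fetch_def[symmetric]
    by (rule hoare_wp_Seq[OF _ hoare_Repeat[OF step assms(2)]])
      (use X0 in \<open>simp_all add: I_def scratch_def loaded_def constants_def\<close>)
  moreover have "(\<exists>i<?n. \<gamma> (x ! i)) \<longleftrightarrow> (\<exists>a\<in>set x. \<gamma> a)" by (metis in_set_conv_nth)
  ultimately show ?thesis
    by (elim hoare_conseq) (auto simp: I_def fetch_def distrib_left)
qed

text \<open>With \<open>s\<close> in register 15 and \<open>t = 2 * s\<close>, the summand of a pile
  \<open>a\<close> is \<open>s - a div 2\<close>. The flag in register 17 marks a pile violating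
  \<open>only_odd_below\<close>. For truncated subtraction, \<open>D - s - c = 0\<close> says
  \<open>D \<le> s + c\<close>.\<close>

definition test_even :: com where
  "test_even = scan (Block [Sub 20 15 19, Add 16 16 20] ;; Unless 20 (Block [Const 17 1]) ;;
     Unless 8 (Block [Const 17 1])) ;; Block [Sub 5 16 15, Sub 22 1 17, Sub 5 5 22]"

lemma hoare_test_even:
  assumes "loaded x X0" "0 < length x"
  shows "hoare (\<lambda>s. s = (X0, u0, v0)) test_even (7 + 12 * length x)
    (\<lambda>(X, u, v). u = u0 \<and> v = v0 \<and> agree scratch X X0 \<and> (X 5 = 0 \<longleftrightarrow> feasible x (2 * X0 15)))"
proof -
  let ?s = "X0 15"
  let ?body = "Block [Sub 20 15 19, Add 16 16 20] ;; Unless 20 (Block [Const 17 1]) ;; Unless 8 (Block [Const 17 1])"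
  have scan: "hoare (\<lambda>s. s = (X0, u0, v0)) (scan ?body) (4 + length x * (code_length ?body + 6))
    (\<lambda>(X, u, v). u = u0 \<and> v = v0 \<and> agree scratch X X0 \<and>
       X 16 = (\<Sum>k<length x. ?s - x ! k div 2) \<and> X 17 = of_bool (\<exists>a\<in>set x. ?s - a div 2 = 0 \<or> a mod 2 = 0))"
  proof (rule hoare_scan[OF assms])
    fix k X Q assume X: "agree scratch X X0" "X 19 = x ! k div 2" "X 8 = x ! k mod 2"
      and Q: "\<And>X'. agree scratch X' X0 \<Longrightarrow> X' 11 = X 11 \<Longrightarrow> X' 18 = X 18 \<Longrightarrow>
        X' 16 = X 16 + (?s - x ! k div 2) \<Longrightarrow>
        X' 17 = (if ?s - x ! k div 2 = 0 \<or> x ! k mod 2 = 0 then 1 else X 17) \<Longrightarrow> Q (X', u0, v0)"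
    have "X 15 = ?s" using agreeD[OF X(1), of 15] by (simp add: scratch_def)
    then show "wp ?body Q (X, u0, v0)"
      using X by (auto simp: scratch_def intro!: Q)
  qed
  have deficit: "deficit x (2 * ?s) = (\<Sum>k<length x. ?s - x ! k div 2)"
    unfolding deficit_def
  proof (rule sum.cong[OF refl])
    fix k
    show "(2 * ?s - x ! k + 1) div 2 = ?s - x ! k div 2"
      by (cases "even (x ! k)") (auto elim!: evenE oddE)
  qed
  have below: "only_odd_below x (2 * ?s) \<longleftrightarrow> \<not> (\<exists>a\<in>set x. ?s - a div 2 = 0 \<or> a mod 2 = 0)"
  proof -
    have "odd a \<and> a < 2 * ?s \<longleftrightarrow> \<not> (?s - a div 2 = 0 \<or> a mod 2 = 0)" for a
      by (cases "even a") (auto elim!: evenE oddE)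
    then show ?thesis by (auto simp: only_odd_below_def)
  qed
  have "hoare (\<lambda>s. s = (X0, u0, v0)) test_even
      (4 + length x * (code_length ?body + 6) + code_length (Block [Sub 5 16 15, Sub 22 1 17, Sub 5 5 22]))
      (\<lambda>(X, u, v). u = u0 \<and> v = v0 \<and> agree scratch X X0 \<and> (X 5 = 0 \<longleftrightarrow> feasible x (2 * ?s)))"
    unfolding test_even_def
  proof (rule hoare_Seq_wp[OF scan])
    fix s assume "case s of (X, u, v) \<Rightarrow> u = u0 \<and> v = v0 \<and> agree scratch X X0 \<and>
       X 16 = (\<Sum>k<length x. ?s - x ! k div 2) \<and> X 17 = of_bool (\<exists>a\<in>set x. ?s - a div 2 = 0 \<or> a mod 2 = 0)"
    then obtain X where s: "s = (X, u0, v0)" and X: "agree scratch X X0"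
      "X 16 = deficit x (2 * ?s)" "X 17 = of_bool (\<not> only_odd_below x (2 * ?s))"
      using deficit below by (cases s) auto
    have "X 15 = ?s" using agreeD[OF X(1), of 15] by (simp add: scratch_def)
    moreover have "X (Suc 0) = 1"
      using loaded_agree[OF X(1) _ assms(1)] by (simp add: scratch_def loaded_def constants_def)
    moreover have "agree scratch (X(5 := a, 22 := b, 5 := c)) X0" for a b c
      using X(1) by (simp add: scratch_def)
    ultimately show "wp (Block [Sub 5 16 15, Sub 22 1 17, Sub 5 5 22]) (\<lambda>(X, u, v). u = u0 \<and> v = v0 \<and>
        agree scratch X X0 \<and> (X 5 = 0 \<longleftrightarrow> feasible x (2 * ?s))) s"
      using X(2,3) by (auto simp: s feasible_def)
  qed
  then show ?thesis by (rule hoare_conseq) auto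
qed

text \<open>For \<open>t = 2 * s + 1\<close> the summand of \<open>a\<close> is
  \<open>s + 1 - a mod 2 - a div 2\<close>; hence \<open>s\<close> and \<open>s + 1\<close> are both
  held, in registers 14 and 15. Register 22 vanishes exactly for an even pile with a positive
  summand, that is, an even pile below \<open>t\<close>.\<close>

definition test_odd :: com where
  "test_odd = scan (Block [Sub 20 15 8, Sub 20 20 19, Add 16 16 20, Sub 22 1 20, Add 22 22 8] ;;
     Unless 22 (Block [Const 17 1])) ;; Block [Sub 5 16 14, Sub 5 5 17]"

lemma hoare_test_odd:
  assumes "loaded x X0" "0 < length x" "X0 15 = Suc (X0 14)"
  shows "hoare (\<lambda>s. s = (X0, u0, v0)) test_odd (6 + 13 * length x)
    (\<lambda>(X, u, v). u = u0 \<and> v = v0 \<and> agree scratch X X0 \<and> (X 5 = 0 \<longleftrightarrow> feasible x (Suc (2 * X0 14))))"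
proof -
  let ?s = "X0 14"
  let ?body = "Block [Sub 20 15 8, Sub 20 20 19, Add 16 16 20, Sub 22 1 20, Add 22 22 8] ;; Unless 22 (Block [Const 17 1])"
  have scan: "hoare (\<lambda>s. s = (X0, u0, v0)) (scan ?body) (4 + length x * (code_length ?body + 6))
    (\<lambda>(X, u, v). u = u0 \<and> v = v0 \<and> agree scratch X X0 \<and>
       X 16 = (\<Sum>k<length x. Suc ?s - x ! k mod 2 - x ! k div 2) \<and>
       X 17 = of_bool (\<exists>a\<in>set x. 1 - (Suc ?s - a mod 2 - a div 2) + a mod 2 = 0))"
  proof (rule hoare_scan[OF assms(1,2)])
    fix k X Q assume X: "agree scratch X X0" "X 19 = x ! k div 2" "X 8 = x ! k mod 2"
      and Q: "\<And>X'. agree scratch X' X0 \<Longrightarrow> X' 11 = X 11 \<Longrightarrow> X' 18 = X 18 \<Longrightarrow>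
        X' 16 = X 16 + (Suc ?s - x ! k mod 2 - x ! k div 2) \<Longrightarrow>
        X' 17 = (if 1 - (Suc ?s - x ! k mod 2 - x ! k div 2) + x ! k mod 2 = 0 then 1 else X 17) \<Longrightarrow>
        Q (X', u0, v0)"
    have "X 15 = Suc ?s" using agreeD[OF X(1), of 15] assms(3) by (simp add: scratch_def)
    moreover have "X (Suc 0) = 1"
      using loaded_agree[OF X(1) _ assms(1)] by (simp add: scratch_def loaded_def constants_def)
    ultimately show "wp ?body Q (X, u0, v0)"
      using X by (auto simp: scratch_def intro!: Q)
  qed
  have deficit: "deficit x (Suc (2 * ?s)) = (\<Sum>k<length x. Suc ?s - x ! k mod 2 - x ! k div 2)"
    unfolding deficit_def
  proof (rule sum.cong[OF refl])
    fix k
    show "(Suc (2 * ?s) - x ! k + 1) div 2 = Suc ?s - x ! k mod 2 - x ! k div 2"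
    proof (cases "even (x ! k)")
      case True
      then obtain b where "x ! k = 2 * b" by (rule evenE)
      then show ?thesis by (cases "b \<le> ?s") (auto simp: Suc_diff_le)
    next
      case False
      then obtain b where "x ! k = 2 * b + 1" by (rule oddE)
      then show ?thesis by simp
    qed
  qed
  have below: "even_below x (Suc (2 * ?s)) \<longleftrightarrow> (\<exists>a\<in>set x. 1 - (Suc ?s - a mod 2 - a div 2) + a mod 2 = 0)"
  proof -
    have "even a \<and> a < Suc (2 * ?s) \<longleftrightarrow> 1 - (Suc ?s - a mod 2 - a div 2) + a mod 2 = 0" for a
      by (cases "even a") (auto elim!: evenE oddE)
    then show ?thesis by (auto simp: even_below_def)
  qed
  have "hoare (\<lambda>s. s = (X0, u0, v0)) test_odd
      (4 + length x * (code_length ?body + 6) + code_length (Block [Sub 5 16 14, Sub 5 5 17]))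
      (\<lambda>(X, u, v). u = u0 \<and> v = v0 \<and> agree scratch X X0 \<and> (X 5 = 0 \<longleftrightarrow> feasible x (Suc (2 * ?s))))"
    unfolding test_odd_def
  proof (rule hoare_Seq_wp[OF scan])
    fix s assume "case s of (X, u, v) \<Rightarrow> u = u0 \<and> v = v0 \<and> agree scratch X X0 \<and>
       X 16 = (\<Sum>k<length x. Suc ?s - x ! k mod 2 - x ! k div 2) \<and>
       X 17 = of_bool (\<exists>a\<in>set x. 1 - (Suc ?s - a mod 2 - a div 2) + a mod 2 = 0)"
    then obtain X where s: "s = (X, u0, v0)" and X: "agree scratch X X0"
      "X 16 = deficit x (Suc (2 * ?s))" "X 17 = of_bool (even_below x (Suc (2 * ?s)))"
      using deficit below by (cases s) auto
    have "X 14 = ?s" using agreeD[OF X(1), of 14] by (simp add: scratch_def)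
    moreover have "agree scratch (X(5 := a, 5 := b)) X0" for a b
      using X(1) by (simp add: scratch_def)
    ultimately show "wp (Block [Sub 5 16 14, Sub 5 5 17]) (\<lambda>(X, u, v). u = u0 \<and> v = v0 \<and>
        agree scratch X X0 \<and> (X 5 = 0 \<longleftrightarrow> feasible x (Suc (2 * ?s)))) s"
      using X(2,3) by (auto simp: s feasible_def)
  qed
  then show ?thesis by (rule hoare_conseq) auto
qed

section \<open>Binary search\<close>

definition push_power :: com where
  "push_power = Block [Store 10 13, Add 10 10 1, Add 13 13 13, Add 21 21 1, Sub 5 12 13]"

definition push_powers :: com where
  "push_powers = Block [Const 13 1, Const 21 0] ;; Repeat push_power 5"

definition powers :: "nat list \<Rightarrow> nat \<Rightarrow> (nat \<Rightarrow> nat) \<Rightarrow> bool" where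
  "powers x k X \<longleftrightarrow> (\<forall>l<k. X (30 + 2 * length x + l) = 2 ^ l)"

lemma loaded_upd: "loaded x X \<Longrightarrow> 4 \<le> i \<Longrightarrow> i \<noteq> 9 \<Longrightarrow> i < 30 \<or> 30 + 2 * length x \<le> i \<Longrightarrow> loaded x (X(i := a))"
  by (auto simp: loaded_def constants_def piles_def)

lemma powers_upd: "powers x k X \<Longrightarrow> i < 30 \<Longrightarrow> powers x k (X(i := a))"
  by (auto simp: powers_def)

lemma hoare_push_powers:
  assumes "0 < K" "\<And>k. 0 < k \<Longrightarrow> k < K \<Longrightarrow> 2 ^ k < V" "V \<le> 2 ^ K"
  shows "hoare (\<lambda>(X, u, v). v = [] \<and> loaded x X \<and> X 10 = 30 + 2 * length x \<and> X 12 = V) push_powers (2 + K * 6)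
    (\<lambda>(X, u, v). v = [] \<and> loaded x X \<and> X 10 = 30 + 2 * length x + K \<and> X 21 = K \<and> powers x K X)"
proof -
  define I where "I = (\<lambda>k (X, u :: word, v :: word). v = [] \<and> loaded x X \<and> X 10 = 30 + 2 * length x + k \<and> X 12 = V \<and>
    X 21 = k \<and> X 13 = 2 ^ k \<and> powers x k X)"
  have step: "hoare (I k) push_power (code_length push_power)
      (\<lambda>s. I (Suc k) s \<and> (0 < fst s 5 \<longleftrightarrow> Suc k < K))" if "k < K" for k
  proof (rule hoare_wp)
    fix s assume "I k s"
    then obtain X u where s: "s = (X, u, [])" and X: "loaded x X" "X 10 = 30 + 2 * length x + k" "X 12 = V"
      "X 21 = k" "X 13 = 2 ^ k" "powers x k X"
      by (cases s) (auto simp: I_def)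
    have one: "X (Suc 0) = 1" using X(1) by (simp add: loaded_def constants_def)
    have twice: "2 ^ k + 2 ^ k = 2 * (2 ^ k :: nat)" by simp
    have "powers x (Suc k) (X(30 + 2 * length x + k := 2 ^ k))"
      using X(6) by (auto simp: powers_def less_Suc_eq)
    moreover have "(0 < V - 2 ^ Suc k) \<longleftrightarrow> Suc k < K"
    proof
      assume "0 < V - 2 ^ Suc k"
      then have "2 ^ Suc k < (2::nat) ^ K" using assms(3) by linarith
      then show "Suc k < K" by (rule power_less_imp_less_exp[rotated]) simp
    next
      assume "Suc k < K"
      then show "0 < V - 2 ^ Suc k" using assms(2)[of "Suc k"] by simp
    qed
    moreover have "fold effect [Store 10 13, Add 10 10 1, Add 13 13 13, Add 21 21 1, Sub 5 12 13] s =
        (X(30 + 2 * length x + k := 2 ^ k, 10 := 30 + 2 * length x + Suc k, 13 := 2 ^ Suc k,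
           21 := Suc k, 5 := V - 2 ^ Suc k), u, [])"
      using X one by (simp add: s twice)
    ultimately show "wp push_power (\<lambda>s. I (Suc k) s \<and> (0 < fst s 5 \<longleftrightarrow> Suc k < K)) s"
      using X unfolding push_power_def wp.simps
      by (simp add: I_def loaded_upd powers_upd del: fold_simps power_Suc)
  qed
  have "hoare (\<lambda>(X, u, v). v = [] \<and> loaded x X \<and> X 10 = 30 + 2 * length x \<and> X 12 = V) push_powers
      (code_length (Block [Const 13 1, Const 21 0]) + K * Suc (code_length push_power)) (I K)"
    unfolding push_powers_def
    by (rule hoare_wp_Seq[OF _ hoare_Repeat[OF step assms(1)]]) (auto simp: I_def loaded_upd powers_def)
  then show ?thesis by (rule hoare_conseq) (auto simp: I_def push_power_def)
qed

text \<open>The case \<open>q = 0\<close> reflects the absence of leading zeros: nothing is printed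
  before the first digit 1, but the last digit always is, so that zero yields
  \<open>[0]\<close>.\<close>

lemma binary_snoc: "e < 2 \<Longrightarrow> binary (2 * q + e) = (if q = 0 then [] else binary q) @ [e]"
  by (subst binary.simps) auto

definition search_step :: com where
  "search_step = Block [Sub 10 10 1, Load 13 10, Add 15 14 13] ;; test_even ;;
     (Block [Const 4 0] ;; Unless 5 (Block [Add 14 15 0, Const 4 1]) ;; Block [Sub 22 1 14] ;;
      Unless 22 (Block [Print 4]) ;; Block [Sub 21 21 1])"

definition search :: com where
  "search = Block [Const 14 0] ;; Repeat search_step 21"

text \<open>Of the \<open>K\<close> binary digits of \<open>S\<close>, the leading \<open>k\<close>
  are decided: register 14 is \<open>S\<close> with the remaining bits cleared, and the output shows
  the decided digits.\<close>

definition search_inv :: "nat list \<Rightarrow> nat \<Rightarrow> nat \<Rightarrow> nat \<Rightarrow> store \<Rightarrow> bool" where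
  "search_inv x K S k = (\<lambda>(X, u, v). loaded x X \<and> X 21 = K - k \<and> X 10 = 30 + 2 * length x + (K - k) \<and>
     powers x K X \<and> X 14 = S div 2 ^ (K - k) * 2 ^ (K - k) \<and>
     v = (if S div 2 ^ (K - k) = 0 then [] else binary (S div 2 ^ (K - k))))"

lemma hoare_search_step:
  assumes "0 < length x" "\<And>s. feasible x (2 * s) \<longleftrightarrow> s \<le> S" "k < K"
  shows "hoare (search_inv x K S k) search_step (18 + 12 * length x)
    (\<lambda>s. search_inv x K S (Suc k) s \<and> (0 < fst s 21 \<longleftrightarrow> Suc k < K))"
proof (rule hoare_pointwise)
  fix s assume "search_inv x K S k s"
  moreover define m where "m = K - Suc k"
  moreover define q where "q = S div 2 ^ Suc m"
  moreover have Km: "K - k = Suc m" using assms(3) by (simp add: m_def)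
  ultimately obtain X u v where s: "s = (X, u, v)" and X: "loaded x X" "X 21 = Suc m"
    "X 10 = 30 + 2 * length x + Suc m" "powers x K X" "X 14 = q * 2 ^ Suc m" and v: "v = (if q = 0 then [] else binary q)"
    by (cases s) (auto simp: search_inv_def)
  have one: "X (Suc 0) = 1" "X 0 = 0" using X(1) by (simp_all add: loaded_def constants_def)
  have "m < K" using assms(3) by (simp add: m_def)
  then have pow: "X (30 + 2 * length x + m) = 2 ^ m" using X(4) by (simp add: powers_def)
  \<comment> \<open>The next digit of \<open>S\<close>, in the form in which the feasibility test of
    the candidate \<open>(2 * q + 1) * 2 ^ m\<close> decides it.\<close>
  define e where "e = (of_bool (2 * q + 1 \<le> S div 2 ^ m) :: nat)"
  have q: "q = S div 2 ^ m div 2" by (simp only: q_def power_Suc2 div_mult2_eq)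
  have e: "S div 2 ^ m = 2 * q + e"
    unfolding e_def q by (cases "even (S div 2 ^ m)") (auto elim!: evenE oddE)
  define X1 where "X1 = X(10 := 30 + 2 * length x + m, 13 := 2 ^ m, 15 := (2 * q + 1) * 2 ^ m)"
  have X1: "loaded x X1" using X(1) by (simp add: X1_def loaded_upd)
  have cand: "feasible x (2 * X1 15) \<longleftrightarrow> e = 1"
  proof -
    have "X1 15 = (2 * q + 1) * 2 ^ m" by (simp add: X1_def)
    then have "feasible x (2 * X1 15) \<longleftrightarrow> (2 * q + 1) * 2 ^ m \<le> S" by (simp only: assms(2))
    also have "\<dots> \<longleftrightarrow> 2 * q + 1 \<le> S div 2 ^ m" by (rule less_eq_div_iff_mult_less_eq[symmetric]) simp
    finally show ?thesis by (simp add: e_def)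
  qed
  have start: "wp (Block [Sub 10 10 1, Load 13 10, Add 15 14 13]) (\<lambda>s. s = (X1, u, v)) s'" if "s' = s" for s'
    using that X one pow by (simp add: s X1_def algebra_simps)
  have finish: "wp (Block [Const 4 0] ;; Unless 5 (Block [Add 14 15 0, Const 4 1]) ;; Block [Sub 22 1 14] ;;
      Unless 22 (Block [Print 4]) ;; Block [Sub 21 21 1])
      (\<lambda>s. search_inv x K S (Suc k) s \<and> (0 < fst s 21 \<longleftrightarrow> Suc k < K)) s'"
    if s': "case s' of (Y, u', v') \<Rightarrow> u' = u \<and> v' = v \<and> agree scratch Y X1 \<and>
      (Y 5 = 0 \<longleftrightarrow> feasible x (2 * X1 15))" for s'
  proof -
    obtain Y where Y: "s' = (Y, u, v)" "agree scratch Y X1" "Y 5 = 0 \<longleftrightarrow> e = 1"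
      using s' cand by (cases s') auto
    have r: "Y 21 = Suc m" "Y 10 = 30 + 2 * length x + m" "Y 14 = q * 2 ^ Suc m" "Y 15 = (2 * q + 1) * 2 ^ m"
      using X by (simp_all add: agreeD[OF Y(2)] scratch_def X1_def)
    have l: "loaded x Y" using loaded_agree[OF Y(2) _ X1] by (simp add: scratch_def)
    then have c: "Y (Suc 0) = 1" "Y 0 = 0" by (simp_all add: loaded_def constants_def)
    have p: "powers x K Y" using X(4) by (simp add: powers_def agreeD[OF Y(2)] scratch_def X1_def)
    have K: "K - Suc k = m" "0 < m \<longleftrightarrow> Suc k < K" by (auto simp: m_def)
    have b: "binary (2 * q + e) = (if q = 0 then [] else binary q) @ [e]"
      by (rule binary_snoc) (simp add: e_def)
    show ?thesis
    proof (cases "e = 1")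
      case True
      \<comment> \<open>The new value of register 14 is positive, so register 22 becomes 0 and the
        digit is printed, even if it is the first one.\<close>
      have "Suc 0 \<le> 2 ^ m + 2 * q * 2 ^ m" by (simp add: Suc_le_eq)
      with True show ?thesis
        using Y(3) r l c p K e b by (simp add: Y(1) v search_inv_def loaded_upd powers_upd)
    next
      case False
      then have "e = 0" by (simp add: e_def of_bool_def split: if_splits)
      then show ?thesis
        using Y(3) r l c p K e b by (auto simp: Y(1) v search_inv_def loaded_upd powers_upd)
    qed
  qed
  show "hoare (\<lambda>s'. s' = s) search_step (18 + 12 * length x)
      (\<lambda>s. search_inv x K S (Suc k) s \<and> (0 < fst s 21 \<longleftrightarrow> Suc k < K))"
    unfolding search_step_def
    by (rule hoare_conseq[OF hoare_wp_Seq[where P = "\<lambda>s'. s' = s",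
      OF start hoare_Seq_wp[OF hoare_test_even[OF X1 assms(1)] finish]]]) auto
qed

lemma hoare_search:
  assumes "0 < length x" "\<And>s. feasible x (2 * s) \<longleftrightarrow> s \<le> S" "0 < K" "S < 2 ^ K"
  shows "hoare (\<lambda>(X, u, v). v = [] \<and> loaded x X \<and> X 10 = 30 + 2 * length x + K \<and> X 21 = K \<and> powers x K X) search
    (1 + K * (19 + 12 * length x))
    (\<lambda>(X, u, v). loaded x X \<and> X 14 = S \<and> v = (if S = 0 then [] else binary S))"
proof -
  have "hoare (\<lambda>(X, u, v). v = [] \<and> loaded x X \<and> X 10 = 30 + 2 * length x + K \<and> X 21 = K \<and> powers x K X) search
      (code_length (Block [Const 14 0]) + K * Suc (18 + 12 * length x)) (search_inv x K S K)"
    unfolding search_def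
    by (rule hoare_wp_Seq[OF _ hoare_Repeat[OF hoare_search_step[OF assms(1,2)] assms(3)]])
      (use assms(4) in \<open>auto simp: search_inv_def loaded_upd powers_upd\<close>)
  then show ?thesis by (rule hoare_conseq) (auto simp: search_inv_def)
qed

definition last_bit :: com where
  "last_bit = Block [Add 15 14 1] ;; test_odd ;; Block [Sub 4 1 5, Print 4]"

lemma hoare_last_bit:
  assumes "0 < length x"
  shows "hoare (\<lambda>(X, u, v). loaded x X \<and> X 14 = S \<and> v = v0) last_bit (9 + 13 * length x)
    (\<lambda>(X, u, v). v = v0 @ [of_bool (feasible x (Suc (2 * S)))])"
proof (rule hoare_pointwise)
  fix s :: store assume "case s of (X, u, v) \<Rightarrow> loaded x X \<and> X 14 = S \<and> v = v0"
  then obtain X u where s: "s = (X, u, v0)" and X: "loaded x X" "X 14 = S" by (cases s) auto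
  define X1 where "X1 = X(15 := Suc S)"
  have X1: "loaded x X1" "X1 15 = Suc (X1 14)" "X1 14 = S" using X by (simp_all add: X1_def loaded_upd)
  have start: "wp (Block [Add 15 14 1]) (\<lambda>s. s = (X1, u, v0)) s'" if "s' = s" for s'
    using that X by (simp add: s X1_def loaded_def constants_def)
  have finish: "wp (Block [Sub 4 1 5, Print 4]) (\<lambda>(X, u, v). v = v0 @ [of_bool (feasible x (Suc (2 * S)))]) s'"
    if s': "case s' of (Y, u', v') \<Rightarrow> u' = u \<and> v' = v0 \<and> agree scratch Y X1 \<and>
      (Y 5 = 0 \<longleftrightarrow> feasible x (Suc (2 * X1 14)))" for s'
  proof -
    obtain Y where Y: "s' = (Y, u, v0)" "agree scratch Y X1" "Y 5 = 0 \<longleftrightarrow> feasible x (Suc (2 * S))"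
      using s' X1(3) by (cases s') auto
    have "Y (Suc 0) = 1"
      using loaded_agree[OF Y(2) _ X1(1)] by (simp add: scratch_def loaded_def constants_def)
    then show ?thesis using Y(3) by (auto simp: Y(1) of_bool_def)
  qed
  show "hoare (\<lambda>s'. s' = s) last_bit (9 + 13 * length x) (\<lambda>(X, u, v). v = v0 @ [of_bool (feasible x (Suc (2 * S)))])"
    unfolding last_bit_def
    by (rule hoare_conseq[OF hoare_wp_Seq[where P = "\<lambda>s'. s' = s",
      OF start hoare_Seq_wp[OF hoare_test_odd[OF X1(1) assms X1(2)] finish]]]) auto
qed

definition solver :: com where
  "solver = read_position ;; push_powers ;; search ;; last_bit"

lemma less_power_bits: "a < 2 ^ bits a"
proof (induction a rule: binary.induct)
  case (1 a)
  show ?case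
  proof (cases "a < 2")
    case True
    then show ?thesis by (simp add: binary.simps[of a])
  next
    case False
    have "a < 2 * (a div 2 + 1)" by simp
    also have "\<dots> \<le> 2 * 2 ^ bits (a div 2)" using 1[OF False] by (intro mult_le_mono2) simp
    finally show ?thesis using False by (simp add: binary.simps[of a])
  qed
qed

text \<open>Bounds the number of stones by a power of two whose exponent is at most the input
  length, which limits the number of search passes.\<close>

lemma Suc_sum_list_le: "Suc (sum_list x) \<le> 2 ^ sum_list (map bits x)"
proof (induction x)
  case (Cons a x)
  have "Suc (sum_list (a # x)) \<le> Suc a * Suc (sum_list x)" by simp
  also have "\<dots> \<le> 2 ^ bits a * 2 ^ sum_list (map bits x)"
    using Cons.IH less_power_bits[of a] by (intro mult_le_mono) auto
  finally show ?case by (simp add: power_add)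
qed simp

lemma length_encode_position:
  "length (encode_position (n, x)) = Suc (bits n) + (sum_list (map bits x) + length x)"
proof -
  have "length (concat (map (\<lambda>a. binary a @ [2]) x)) = sum_list (map bits x) + length x" for x
    by (induction x) auto
  then show ?thesis by (simp add: encode_position_def)
qed

lemma symbols_encode_position: "a \<in> set (encode_position (n, x)) \<Longrightarrow> a \<le> 2"
  by (auto simp: encode_position_def split: if_splits dest!: digit_binary)

lemma hoare_solver:
  assumes "2 \<le> length x" "L = length (encode_position (length x, x))"
  shows "hoare (\<lambda>s. s = (\<lambda>_. 0, encode_position (length x, x), [])) solver (31 + 66 * L + 21 * L ^ 2)
    (\<lambda>(X, u, v). v = binary (rank x))"
proof -
  let ?n = "length x"
  let ?V = "2 + sum_list x"
  define S where "S = rank x div 2"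
  have L: "L = Suc (bits ?n) + (sum_list (map bits x) + ?n)"
    using assms(2) by (simp add: length_encode_position)
  have n: "0 < ?n" "?n \<le> L" using assms(1) L by auto
  have bits_le: "bits a \<le> L" if "a \<in> set x" for a
  proof -
    have "bits a \<le> sum_list (map bits x)" using that by (intro member_le_sum_list) auto
    then show ?thesis using L by simp
  qed
  have V: "?V \<le> 2 ^ L"
  proof -
    have "?V \<le> 2 ^ sum_list (map bits x) + 1" using Suc_sum_list_le[of x] by simp
    also have "\<dots> \<le> 2 ^ Suc (sum_list (map bits x))" by simp
    also have "\<dots> \<le> 2 ^ L" using L by (intro power_increasing) auto
    finally show ?thesis .
  qed
  \<comment> \<open>The exponent at which \<open>push_powers\<close> stops, hence the number of
    powers on the stack and of passes of the search.\<close>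
  define K where "K = (LEAST k. 0 < k \<and> ?V \<le> 2 ^ k)"
  have ex: "0 < L \<and> ?V \<le> 2 ^ L" using V L by simp
  have K: "0 < K" "?V \<le> 2 ^ K" "K \<le> L"
    using LeastI[of "\<lambda>k. 0 < k \<and> ?V \<le> 2 ^ k", OF ex] Least_le[of "\<lambda>k. 0 < k \<and> ?V \<le> 2 ^ k", OF ex]
    unfolding K_def by auto
  have K_min: "2 ^ k < ?V" if "0 < k" "k < K" for k
    using not_less_Least[of k "\<lambda>k. 0 < k \<and> ?V \<le> 2 ^ k"] that unfolding K_def by (meson not_le)
  have S: "feasible x (2 * s) \<longleftrightarrow> s \<le> S" for s
    using feasible_iff[OF assms(1), of "2 * s"] by (auto simp: S_def)
  have "2 * S \<le> ?V" using feasible_le[OF assms(1), of "2 * S"] S[of S] by simp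
  then have "S < ?V" by simp
  then have S_less: "S < 2 ^ K" using K(2) by linarith
  \<comment> \<open>\<open>S\<close> is half of the rank, rounded down, so feasibility at
    \<open>2 * S + 1\<close> decides the parity of the rank.\<close>
  have rank: "rank x = 2 * S + of_bool (feasible x (Suc (2 * S)))"
    using feasible_iff[OF assms(1), of "Suc (2 * S)"] by (cases "even (rank x)") (auto simp: S_def elim!: evenE oddE)
  have "(if S = 0 then [] else binary S) @ [of_bool (feasible x (Suc (2 * S)))] = binary (rank x)"
    unfolding rank by (rule binary_snoc[symmetric]) simp
  \<comment> \<open>With \<open>K\<close> and the number of piles at most \<open>L\<close>, the
    linear terms add up to \<open>9 + 25 + 32 = 66\<close> and the quadratic ones to
    \<open>9 + 12 = 21\<close>.\<close>
  moreover have "19 + 9 * L + ?n * (19 + 9 * L) + ((2 + K * 6) + ((1 + K * (19 + 12 * ?n)) + (9 + 13 * ?n)))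
      \<le> 31 + 66 * L + 21 * L ^ 2"
  proof -
    have "?n * (19 + 9 * L) \<le> L * (19 + 9 * L)" "K * (19 + 12 * ?n) \<le> L * (19 + 12 * L)"
      using n(2) K(3) by (auto intro!: mult_le_mono)
    then show ?thesis using n(2) K(3) by (simp add: power2_eq_square algebra_simps)
  qed
  ultimately show ?thesis
    unfolding solver_def
    by (intro hoare_conseq[OF hoare_Seq[OF hoare_read_position[OF n(1), of L]
        hoare_Seq[OF hoare_push_powers[OF K(1) K_min K(2)]
          hoare_Seq[OF hoare_search[OF n(1) S K(1) S_less] hoare_last_bit[OF n(1)]]]]])
      (use bits_le L in auto)
qed

text \<open>The largest constant is the start of the stack, 30; it also exceeds all input
  symbols.\<close>

lemma constants_solver: "consts_le 30 (code 0 solver)"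
  by (simp add: consts_le_def solver_def read_position_def read_number_def read_digit_def store_number_def
      push_powers_def push_power_def search_def search_step_def last_bit_def test_even_def test_odd_def scan_def)

theorem theorem3:
  "polytime_computable_on {(n, x). 2 \<le> n \<and> x \<in> nim_positions n} encode_position binary
     (\<lambda>(n, x). remoteness (nim n (n - 1)) x)"
proof -
  define m :: "nat poly" where "m = [:31, 66, 21:]"
  \<comment> \<open>\<open>m\<close> bounds the steps, and \<open>p\<close> is the resulting cost
    bound \<open>m * (2 * (bits 30 + m))\<close> with \<open>bits 30 = 5\<close>.\<close>
  define p :: "nat poly" where "p = m * (smult 2 (m + [:5:]))"
  have "\<exists>t \<le> poly p (length (encode_position (n, x))).
      halts_with (code 0 solver) (encode_position (n, x)) (binary (remoteness (nim n (n - 1)) x)) t"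
    if "2 \<le> n" "x \<in> nim_positions n" for n x
  proof -
    have x: "length x = n" using that(2) by (simp add: nim_positions_def)
    let ?L = "length (encode_position (n, x))"
    have m: "poly m ?L = 31 + 66 * ?L + 21 * ?L ^ 2" by (simp add: m_def power2_eq_square algebra_simps)
    have bits: "bits 30 = 5" by (simp add: binary.simps)
    have "\<exists>t \<le> poly m ?L * (2 * (bits 30 + poly m ?L)).
        halts_with (code 0 solver) (encode_position (n, x)) (binary (rank x)) t"
      unfolding m
      using hoare_solver[of x ?L] that(1) x constants_solver symbols_encode_position[of _ n x]
      by (intro halts_with_hoare) fastforce+
    moreover have "poly m ?L * (2 * (bits 30 + poly m ?L)) = poly p ?L" by (simp add: p_def bits algebra_simps)
    ultimately show ?thesis using remoteness_nim[of x] that(1) x by simp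
  qed
  then show ?thesis
    unfolding polytime_computable_on_def by (intro exI[of _ "code 0 solver"] exI[of _ p]) auto
qed

end
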